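(* Let $A$ be a C$^*$-algebra and let $H$ be a complex Hilbert space. Every 2-local representation $T: A\to B(H)$ of $A$ is a representation of $A$, i.e. $T$ is a (bounded linear) homomorphism.
   Context: C$^*$-algebras are complex and not assumed to be unital. $B(H)$ is the C$^*$-algebra of all bounded linear operators on $H$. A homomorphism between C$^*$-algebras is a linear multiplicative map (not assumed to preserve the involution). A bounded linear map $T: A\to B(H)$ is called a 2-local representation of $A$ if it is a 2-local homomorphism, that is, for every $a,b\in A$ there exists a bounded homomorphism $\Phi_{a,b}: A\to B(H)$, depending on $a$ and $b$, such that $\Phi_{a,b}(a)=T(a)$ and $\Phi_{a,b}(b)=T(b)$. A representation of $A$ here means a bounded homomorphism $A\to B(H)$. *)

theory Defs
  imports "HOL-Analysis.Analysis"
begin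

class scaleC =
  fixes scaleC :: "complex \<Rightarrow> 'a \<Rightarrow> 'a"  (infixr "*\<^sub>C" 75)

class complex_normed_vector = real_normed_vector + scaleC +
  assumes scaleC_add_right: "c *\<^sub>C (x + y) = c *\<^sub>C x + c *\<^sub>C y"
    and scaleC_add_left: "(c + d) *\<^sub>C x = c *\<^sub>C x + d *\<^sub>C x"
    and scaleC_scaleC: "c *\<^sub>C d *\<^sub>C x = (c * d) *\<^sub>C x"
    and scaleR_scaleC: "r *\<^sub>R x = complex_of_real r *\<^sub>C x"
    and norm_scaleC: "norm (c *\<^sub>C x) = cmod c * norm x"

text \<open>As in \<^class>\<open>real_normed_algebra\<close>, no unit is required.\<close>

class complex_normed_algebra = complex_normed_vector + real_normed_algebra +
  assumes mult_scaleC_left: "(c *\<^sub>C x) * y = c *\<^sub>C (x * y)"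
    and mult_scaleC_right: "x * (c *\<^sub>C y) = c *\<^sub>C (x * y)"

class c_star_algebra = complex_normed_algebra + complete_space +
  fixes star :: "'a \<Rightarrow> 'a"
  assumes star_star: "star (star x) = x"
    and star_add: "star (x + y) = star x + star y"
    and star_scaleC: "star (c *\<^sub>C x) = cnj c *\<^sub>C star x"
    and star_mult: "star (x * y) = star y * star x"
    and norm_star_mult_self: "norm (star x * x) = (norm x)\<^sup>2"

text \<open>The inner product is linear in its first argument. The last axiom contains positive
  definiteness, since \<^const>\<open>norm\<close> is already a norm.\<close>

class complex_inner = complex_normed_vector +
  fixes cinner :: "'a \<Rightarrow> 'a \<Rightarrow> complex"
  assumes cinner_commute: "cinner x y = cnj (cinner y x)"
    and cinner_add_left: "cinner (x + y) z = cinner x z + cinner y z"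
    and cinner_scaleC_left: "cinner (c *\<^sub>C x) y = c * cinner x y"
    and cinner_self: "cinner x x = complex_of_real ((norm x)\<^sup>2)"

class complex_hilbert_space = complex_inner + complete_space

instantiation complex :: c_star_algebra
begin
definition scaleC_complex :: "complex \<Rightarrow> complex \<Rightarrow> complex" where "scaleC_complex c x = c * x"
definition star_complex :: "complex \<Rightarrow> complex" where "star_complex = cnj"
instance
  by standard
    (auto simp: scaleC_complex_def star_complex_def algebra_simps norm_mult scaleR_conv_of_real
      power2_eq_square)
end

instantiation complex :: complex_hilbert_space
begin
definition cinner_complex :: "complex \<Rightarrow> complex \<Rightarrow> complex" where "cinner_complex x y = x * cnj y"
instance
  by standard
    (auto simp: scaleC_complex_def cinner_complex_def algebra_simps
      simp flip: complex_norm_square of_real_power)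
end

definition bounded_clinear ::
    "('a::complex_normed_vector \<Rightarrow> 'b::complex_normed_vector) \<Rightarrow> bool" where
  "bounded_clinear f \<longleftrightarrow> bounded_linear f \<and> (\<forall>c x. f (c *\<^sub>C x) = c *\<^sub>C f x)"

text \<open>The algebra \<open>B(H)\<close>, with composition as product and the operator norm, both inherited from
  the type of bounded real-linear maps.\<close>

typedef (overloaded) 'h bounded_op =
    "{F :: 'h::complex_normed_vector \<Rightarrow>\<^sub>L 'h. bounded_clinear (blinfun_apply F)}"
  morphisms blinfun_of_bop bop_of_blinfun
  by (rule exI[of _ 0])
     (simp add: bounded_clinear_def blinfun.bounded_linear_right
        norm_scaleC flip: norm_le_zero_iff)

setup_lifting type_definition_bounded_op

lift_definition bop_apply :: "'h::complex_normed_vector bounded_op \<Rightarrow> 'h \<Rightarrow> 'h"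
  is blinfun_apply .

lemma scaleC_zero_right: "c *\<^sub>C (0::'a::complex_normed_vector) = 0"
  using norm_scaleC[of c "0::'a"] by simp

lemma scaleC_minus_right: "c *\<^sub>C (- x) = - (c *\<^sub>C (x::'a::complex_normed_vector))"
  using scaleC_add_right[of c x "- x"]
  by (simp add: scaleC_zero_right eq_neg_iff_add_eq_0 add.commute)

lemma scaleC_diff_right:
  "c *\<^sub>C (x - y) = c *\<^sub>C x - c *\<^sub>C (y::'a::complex_normed_vector)"
  using scaleC_add_right[of c x "- y"] by (simp add: scaleC_minus_right)

lemma bounded_clinear_blinfun_iff:
  "bounded_clinear (blinfun_apply F) \<longleftrightarrow> (\<forall>c x. F (c *\<^sub>C x) = c *\<^sub>C F x)"
  by (simp add: bounded_clinear_def blinfun.bounded_linear_right)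

lemma bounded_linear_scaleC: "bounded_linear (\<lambda>x::'a::complex_normed_vector. c *\<^sub>C x)"
  by (rule bounded_linear_intro[where K = "cmod c"])
     (simp_all add: scaleC_add_right scaleR_scaleC scaleC_scaleC norm_scaleC mult.commute)

lift_definition blinfun_scaleC :: "complex \<Rightarrow> 'h::complex_normed_vector \<Rightarrow>\<^sub>L 'h" is "\<lambda>c x. c *\<^sub>C x"
  by (rule bounded_linear_scaleC)

lemma norm_blinfun_scaleC: "norm (blinfun_scaleC c o\<^sub>L F) = cmod c * norm F"
proof -
  have "onorm (\<lambda>x. c *\<^sub>C blinfun_apply F x) = onorm (\<lambda>x. cmod c *\<^sub>R blinfun_apply F x)"
    by (simp add: onorm_def norm_scaleC)
  also have "\<dots> = cmod c * onorm (blinfun_apply F)"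
    by (simp add: onorm_scaleR blinfun.bounded_linear_right)
  finally show ?thesis
    by (simp add: norm_blinfun.rep_eq blinfun_scaleC.rep_eq blinfun_compose.rep_eq o_def)
qed

instantiation bounded_op :: (complex_normed_vector) complex_normed_algebra
begin

lift_definition zero_bounded_op :: "'a bounded_op" is 0
  by (simp add: bounded_clinear_blinfun_iff scaleC_zero_right)
lift_definition plus_bounded_op :: "'a bounded_op \<Rightarrow> 'a bounded_op \<Rightarrow> 'a bounded_op" is "(+)"
  by (simp add: bounded_clinear_blinfun_iff blinfun.add_left scaleC_add_right)
lift_definition minus_bounded_op :: "'a bounded_op \<Rightarrow> 'a bounded_op \<Rightarrow> 'a bounded_op" is "(-)"
  by (simp add: bounded_clinear_blinfun_iff blinfun.diff_left scaleC_diff_right)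
lift_definition uminus_bounded_op :: "'a bounded_op \<Rightarrow> 'a bounded_op" is uminus
  by (simp add: bounded_clinear_blinfun_iff blinfun.minus_left scaleC_minus_right)
lift_definition times_bounded_op :: "'a bounded_op \<Rightarrow> 'a bounded_op \<Rightarrow> 'a bounded_op" is "(o\<^sub>L)"
  by (simp add: bounded_clinear_blinfun_iff)
lift_definition scaleC_bounded_op :: "complex \<Rightarrow> 'a bounded_op \<Rightarrow> 'a bounded_op"
  is "\<lambda>c F. blinfun_scaleC c o\<^sub>L F"
  by (simp add: bounded_clinear_blinfun_iff blinfun_scaleC.rep_eq scaleC_scaleC mult.commute)
lift_definition scaleR_bounded_op :: "real \<Rightarrow> 'a bounded_op \<Rightarrow> 'a bounded_op" is "(*\<^sub>R)"
  by (simp add: bounded_clinear_blinfun_iff blinfun.scaleR_left scaleR_scaleC scaleC_scaleC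
      mult.commute)
lift_definition norm_bounded_op :: "'a bounded_op \<Rightarrow> real" is norm .

definition dist_bounded_op :: "'a bounded_op \<Rightarrow> 'a bounded_op \<Rightarrow> real"
  where "dist_bounded_op F G = norm (F - G)"
definition sgn_bounded_op :: "'a bounded_op \<Rightarrow> 'a bounded_op"
  where "sgn_bounded_op F = scaleR (inverse (norm F)) F"
definition uniformity_bounded_op :: "('a bounded_op \<times> 'a bounded_op) filter"
  where "uniformity_bounded_op = (INF e\<in>{0<..}. principal {(F, G). dist F G < e})"
definition open_bounded_op :: "'a bounded_op set \<Rightarrow> bool"
  where "open_bounded_op U = (\<forall>F\<in>U. \<forall>\<^sub>F (F', G) in uniformity. F' = F \<longrightarrow> G \<in> U)"

instance
proof
  fix F G K :: "'a bounded_op" and r s :: real and c d :: complex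
  show "F + G + K = F + (G + K)" by transfer simp
  show "F + G = G + F" by transfer simp
  show "0 + F = F" by transfer simp
  show "- F + F = 0" by transfer simp
  show "F - G = F + - G" by transfer simp
  show "r *\<^sub>R (F + G) = r *\<^sub>R F + r *\<^sub>R G" by transfer (simp add: scaleR_add_right)
  show "(r + s) *\<^sub>R F = r *\<^sub>R F + s *\<^sub>R F" by transfer (simp add: scaleR_add_left)
  show "r *\<^sub>R s *\<^sub>R F = (r * s) *\<^sub>R F" by transfer simp
  show "1 *\<^sub>R F = F" by transfer simp
  show "dist F G = norm (F - G)" by (rule dist_bounded_op_def)
  show "sgn F = scaleR (inverse (norm F)) F" by (rule sgn_bounded_op_def)
  show "(uniformity :: ('a bounded_op \<times> 'a bounded_op) filter)
      = (INF e\<in>{0<..}. principal {(x, y). dist x y < e})"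
    by (rule uniformity_bounded_op_def)
  show "open U = (\<forall>x\<in>U. \<forall>\<^sub>F (x', y) in uniformity. x' = x \<longrightarrow> y \<in> U)"
    for U :: "'a bounded_op set"
    by (rule open_bounded_op_def)
  show "norm F = 0 \<longleftrightarrow> F = 0" by transfer simp
  show "norm (F + G) \<le> norm F + norm G" by transfer (rule norm_triangle_ineq)
  show "norm (r *\<^sub>R F) = \<bar>r\<bar> * norm F" by transfer simp
  show "c *\<^sub>C (F + G) = c *\<^sub>C F + c *\<^sub>C G"
    by transfer (auto intro!: blinfun_eqI simp: blinfun_scaleC.rep_eq blinfun.add_left scaleC_add_right)
  show "(c + d) *\<^sub>C F = c *\<^sub>C F + d *\<^sub>C F"
    by transfer (auto intro!: blinfun_eqI simp: blinfun_scaleC.rep_eq blinfun.add_left scaleC_add_left)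
  show "c *\<^sub>C d *\<^sub>C F = (c * d) *\<^sub>C F"
    by transfer (auto intro!: blinfun_eqI simp: blinfun_scaleC.rep_eq scaleC_scaleC)
  show "r *\<^sub>R F = complex_of_real r *\<^sub>C F"
    by transfer (auto intro!: blinfun_eqI simp: blinfun_scaleC.rep_eq blinfun.scaleR_left scaleR_scaleC)
  show "norm (c *\<^sub>C F) = cmod c * norm F"
    by transfer (rule norm_blinfun_scaleC)
  show "F * G * K = F * (G * K)" by transfer (auto intro!: blinfun_eqI)
  show "(F + G) * K = F * K + G * K" by transfer (auto intro!: blinfun_eqI simp: blinfun.add_left)
  show "F * (G + K) = F * G + F * K"
    by transfer (auto intro!: blinfun_eqI simp: blinfun.add_left blinfun.add_right)
  show "(r *\<^sub>R F) * G = r *\<^sub>R (F * G)"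
    by transfer (auto intro!: blinfun_eqI simp: blinfun.scaleR_left)
  show "F * (r *\<^sub>R G) = r *\<^sub>R (F * G)"
    by transfer (auto intro!: blinfun_eqI simp: blinfun.scaleR_left blinfun.scaleR_right)
  show "norm (F * G) \<le> norm F * norm G" by transfer (rule norm_blinfun_compose)
  show "(c *\<^sub>C F) * G = c *\<^sub>C (F * G)" by transfer (auto intro!: blinfun_eqI)
  show "F * (c *\<^sub>C G) = c *\<^sub>C (F * G)"
    by transfer (auto intro!: blinfun_eqI simp: blinfun_scaleC.rep_eq bounded_clinear_blinfun_iff)
qed

end

lemma bop_apply_plus: "bop_apply (F + G) x = bop_apply F x + bop_apply G x"
  by transfer (simp add: blinfun.add_left)

lemma bop_apply_scaleC: "bop_apply (c *\<^sub>C F) x = c *\<^sub>C bop_apply F x"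
  by transfer (simp add: blinfun_scaleC.rep_eq)

lemma bop_apply_times: "bop_apply (F * G) x = bop_apply F (bop_apply G x)"
  by transfer simp

lemma range_bop_apply: "range bop_apply = {f. bounded_clinear f}"
proof (intro set_eqI iffI)
  fix f :: "'a \<Rightarrow> 'a" assume "f \<in> {f. bounded_clinear f}"
  then have f: "bounded_clinear f" by simp
  then have "blinfun_apply (Blinfun f) = f"
    by (simp add: bounded_clinear_def bounded_linear_Blinfun_apply)
  with f have "bop_apply (bop_of_blinfun (Blinfun f)) = f"
    by (simp add: bop_apply.rep_eq bop_of_blinfun_inverse)
  then show "f \<in> range bop_apply" by (metis rangeI)
next
  fix f :: "'a \<Rightarrow> 'a" assume "f \<in> range bop_apply"
  then show "f \<in> {f. bounded_clinear f}"
    using blinfun_of_bop by (auto simp: bop_apply.rep_eq)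
qed

text \<open>Homomorphisms are not required to preserve an involution (or a unit).\<close>

definition bounded_homomorphism ::
    "('a::complex_normed_algebra \<Rightarrow> 'b::complex_normed_algebra) \<Rightarrow> bool" where
  "bounded_homomorphism \<Phi> \<longleftrightarrow> bounded_clinear \<Phi> \<and> (\<forall>a b. \<Phi> (a * b) = \<Phi> a * \<Phi> b)"

definition cstar_representation ::
    "('a::c_star_algebra \<Rightarrow> 'h::complex_hilbert_space bounded_op) \<Rightarrow> bool" where
  "cstar_representation \<Phi> \<longleftrightarrow> bounded_homomorphism \<Phi>"

definition two_local_representation ::
    "('a::c_star_algebra \<Rightarrow> 'h::complex_hilbert_space bounded_op) \<Rightarrow> bool" where
  "two_local_representation T \<longleftrightarrow>
     bounded_clinear T \<and> (\<forall>a b. \<exists>\<Phi>. bounded_homomorphism \<Phi> \<and> \<Phi> a = T a \<and> \<Phi> b = T b)"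

end

theory Submission
  imports Defs
    "HOL-Complex_Analysis.Cauchy_Integral_Formula"
    "HOL-Real_Asymp.Real_Asymp"
begin

text \<open>A 2-local representation \<open>T\<close> sees only pairs of elements, but this suffices for two things.
  Applied to \<open>a\<close> and \<open>a * a\<close>, it shows that \<open>T\<close> preserves squares; applied to \<open>a\<close> and \<open>b\<close> with
  \<open>a * b = 0\<close>, it shows that \<open>T a * T b = 0\<close>. So the defect \<open>D a b = T (a * b) - T a * T b\<close> is a
  bounded bilinear map that is alternating and that vanishes whenever \<open>a * b = 0\<close>. A C*-algebra has
  so many zero products that such a map is zero; this is \<open>zero_product_alternating_eq_0\<close>, which
  rests on the two facts below.

  The first is that every bounded bilinear \<open>\<phi>\<close> that vanishes on zero products (and over which complex
  scalars can be moved) is balanced: \<open>\<phi> (a * x) b = \<phi> a (x * b)\<close> (\<open>zero_product_balanced\<close>). To see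
  this, let \<open>u\<close> be a unitary and let continuous real functions \<open>f\<close>, \<open>g\<close> on the circle act on \<open>a\<close> from
  the right and on \<open>b\<close> from the left by functional calculus in \<open>u\<close>. If \<open>f\<close> and \<open>g\<close> have product
  zero, then so do \<open>a f(u)\<close> and \<open>g(u) b\<close>, so \<open>\<phi> (a f(u)) (g(u) b)\<close> is a bilinear map on continuous
  functions that kills disjoint pairs; such a map takes the same value at \<open>(g, 1)\<close> and \<open>(1, g)\<close>
  (\<open>disjointness_bilinear_shift\<close>, by cutting \<open>g\<close> into thin layers). With \<open>g\<close> the rescaled real and
  imaginary parts of the coordinate one gets balancedness for \<open>u\<close>. Finally the Cayley transform of a small
  skew-adjoint \<open>k\<close> is a unitary, balancedness passes from it to \<open>k\<close> by a short computation, and the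
  skew-adjoint contractions generate the algebra as a complex vector space.

  The second is that products span a dense subspace, in the form that a bounded linear map that kills
  all products is zero (\<open>zero_if_zero_on_products\<close>). Given the two facts, moving factors around a
  triple product and using antisymmetry three times yields \<open>D (x * y) z = - D (x * y) z\<close>; so \<open>D\<close>
  vanishes on products in its first argument, hence everywhere.

  The algebra may lack a unit, so a unitary \<open>u = 1 + v\<close> of the unitization is represented by \<open>v\<close>,
  and only the maps \<open>x \<mapsto> x u\<close> and \<open>x \<mapsto> x u\<^sup>*\<close> are used. The calculus for \<open>u\<close> needs the estimate
  \<open>\<parallel>x p(u)\<parallel> \<le> \<parallel>x\<parallel> sup \<bar>p\<bar>\<close> over the unit circle (\<open>norm_poly_act_le\<close>), which the C*-identity bootstraps
  from a crude bound that grows linearly in the degree of \<open>p\<close>.\<close>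

section \<open>Bilinear maps that vanish on disjoint functions\<close>

lemma apply_bcontfun_sum:
  "apply_bcontfun (\<Sum>i\<in>I. f i) x = (\<Sum>i\<in>I. apply_bcontfun (f i :: 'x::topological_space \<Rightarrow>\<^sub>C real) x)"
  by (induction I rule: infinite_finite_induct) auto

lemma sum_clamp_steps:
  fixes y :: real
  assumes "0 \<le> y" "y \<le> real N"
  shows "(\<Sum>j<N. max 0 (min 1 (y - real j))) = y"
  using assms
proof (induction N arbitrary: y)
  case (Suc N)
  show ?case
  proof (cases "y \<le> real N")
    case True
    then show ?thesis using Suc.IH[of y] Suc.prems by simp
  next
    case False
    have "(\<Sum>j<N. max 0 (min 1 (y - real j))) = (\<Sum>j<N. 1)"
      using False by (intro sum.cong) auto
    then show ?thesis using Suc.prems False by simp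
  qed
qed simp

text \<open>For \<open>g \<ge> 0\<close> the ramps descend from the constant 1 at \<open>j = 0\<close>: the ramp number \<open>j\<close>
  vanishes where \<open>N g \<le> j - 1\<close> and is 1 where \<open>N g \<ge> j\<close>. The difference of two consecutive ramps is a
  tent that lives on the layer where \<open>N g\<close> is between \<open>j - 1\<close> and \<open>j + 1\<close>.\<close>

definition ramp :: "('x::topological_space \<Rightarrow>\<^sub>C real) \<Rightarrow> real \<Rightarrow> nat \<Rightarrow> 'x \<Rightarrow>\<^sub>C real" where
  "ramp g N j = Bcontfun (\<lambda>x. max 0 (min 1 (N * apply_bcontfun g x + 1 - real j)))"

lemma apply_ramp:
  "apply_bcontfun (ramp g N j) x = max 0 (min 1 (N * apply_bcontfun g x + 1 - real j))"
proof -
  have "(\<lambda>x. max 0 (min 1 (N * apply_bcontfun g x + 1 - real j))) \<in> bcontfun"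
    unfolding bcontfun_def
    by (auto intro!: continuous_intros boundedI[where B=1])
  then show ?thesis
    by (simp add: ramp_def Bcontfun_inverse)
qed

lemma bilinear_sum_orthogonal:
  assumes "bounded_bilinear F" and "finite I"
    and "\<And>i j. i \<in> I \<Longrightarrow> j \<in> I \<Longrightarrow> i \<noteq> j \<Longrightarrow> F (x i) (y j) = 0"
  shows "F (\<Sum>i\<in>I. x i) (\<Sum>j\<in>I. y j) = (\<Sum>i\<in>I. F (x i) (y i))"
proof -
  have "F (\<Sum>i\<in>I. x i) (\<Sum>j\<in>I. y j) = (\<Sum>i\<in>I. \<Sum>j\<in>I. F (x i) (y j))"
    by (simp add: bounded_bilinear.sum_left[OF assms(1)] bounded_bilinear.sum_right[OF assms(1)])
       (rule sum.swap)
  also have "\<dots> = (\<Sum>i\<in>I. \<Sum>j\<in>I. if j = i then F (x i) (y i) else 0)"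
    using assms(3) by (intro sum.cong refl) auto
  also have "\<dots> = (\<Sum>i\<in>I. F (x i) (y i))"
    using assms(2) by simp
  finally show ?thesis .
qed

text \<open>For the indicator \<open>h\<close> of a set both \<open>F h 1\<close> and \<open>F 1 h\<close> would equal \<open>F h h\<close>, because \<open>h\<close> and
  \<open>1 - h\<close> are disjoint. A continuous \<open>g\<close> is the average of \<open>N\<close> ramps, which are approximate
  indicators of the sets where \<open>g\<close> exceeds a threshold; for a ramp the two values differ by an error
  that involves only two neighbouring tents. Tents whose indices differ by at least 2 are disjoint, so along a
  residue class modulo 3 the errors add up to two values of \<open>F\<close> at functions of norm at most 1.
  The \<open>N\<close> errors therefore have a sum bounded independently of \<open>N\<close>, and averaging makes it vanish.\<close>

lemma disjointness_bilinear_shift: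
  fixes F :: "('x::topological_space \<Rightarrow>\<^sub>C real) \<Rightarrow> ('x \<Rightarrow>\<^sub>C real) \<Rightarrow> 'v::real_normed_vector"
  assumes F: "bounded_bilinear F"
    and disj: "\<And>f g. (\<And>x. apply_bcontfun f x * apply_bcontfun g x = 0) \<Longrightarrow> F f g = 0"
    and g: "\<And>x. 0 \<le> apply_bcontfun g x" "\<And>x. apply_bcontfun g x \<le> 1"
  shows "F g (const_bcontfun 1) = F (const_bcontfun 1) g"
proof -
  interpret F: bounded_bilinear F by (fact F)
  obtain K where K: "K \<ge> 0" "\<And>a b. norm (F a b) \<le> norm a * norm b * K"
    using F.nonneg_bounded by blast
  let ?one = "const_bcontfun 1 :: 'x \<Rightarrow>\<^sub>C real"
  have bound: "real n * norm (F g ?one - F ?one g) \<le> 2 * K" if n: "n > 0" for n :: nat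
  proof -
    define N where "N = 3 * n"
    define c where "c = ramp g (real N)"
    define d where "d j = c j - c (Suc j)" for j
    have cx: "apply_bcontfun (c j) x = max 0 (min 1 (real N * apply_bcontfun g x + 1 - real j))" for j x
      by (simp add: c_def apply_ramp)
    have c_anti: "apply_bcontfun (c i) x \<ge> apply_bcontfun (c j) x" if "i \<le> j" for i j x
      using that by (auto simp: cx)
    have c01: "0 \<le> apply_bcontfun (c j) x" "apply_bcontfun (c j) x \<le> 1" for j x
      by (auto simp: cx)
    \<comment> \<open>Each ramp is 1 where the next one is positive, and each tent dies before the second next
      ramp starts; so only neighbouring tents interact.\<close>
    have z1: "F (c (Suc j)) (?one - c j) = 0" "F (?one - c j) (c (Suc j)) = 0" for j
      by (rule disj; auto simp: cx const_bcontfun.rep_eq max_def min_def)+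
    have z2: "F (c (Suc (Suc j))) (d j) = 0" "F (d j) (c (Suc (Suc j))) = 0" for j
      by (rule disj; auto simp: cx d_def max_def min_def)+
    have z3: "F (d i) (d j) = 0" if "i \<ge> j + 2" for i j
      using that by (intro disj) (auto simp: cx d_def max_def min_def)
    have z3': "F (d i) (d j) = 0" if "j \<ge> i + 2" for i j
      using that by (intro disj) (auto simp: cx d_def max_def min_def)
    have step: "F (c (Suc j)) ?one - F ?one (c (Suc j)) = F (d (Suc j)) (d j) - F (d j) (d (Suc j))" for j
    proof -
      have "F (c (Suc j)) ?one = F (c (Suc j)) (c j)"
        using z1(1)[of j] by (simp add: F.diff_right)
      also have "\<dots> = F (c (Suc j)) (d j) + F (c (Suc j)) (c (Suc j))"
        by (simp add: d_def F.diff_right)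
      also have "F (c (Suc j)) (d j) = F (d (Suc j)) (d j)"
        using z2(1)[of j] by (simp add: d_def[of "Suc j"] F.diff_left)
      finally have 1: "F (c (Suc j)) ?one = F (d (Suc j)) (d j) + F (c (Suc j)) (c (Suc j))" .
      have "F ?one (c (Suc j)) = F (c j) (c (Suc j))"
        using z1(2)[of j] by (simp add: F.diff_left)
      also have "\<dots> = F (d j) (c (Suc j)) + F (c (Suc j)) (c (Suc j))"
        by (simp add: d_def F.diff_left)
      also have "F (d j) (c (Suc j)) = F (d j) (d (Suc j))"
        using z2(2)[of j] by (simp add: d_def[of "Suc j"] F.diff_right)
      finally show ?thesis using 1 by simp
    qed
    have gsum: "real N *\<^sub>R g = (\<Sum>j<N. c (Suc j))"
    proof (rule bcontfun_eqI)
      fix x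
      have "apply_bcontfun (\<Sum>j<N. c (Suc j)) x = (\<Sum>j<N. max 0 (min 1 (real N * apply_bcontfun g x - real j)))"
        by (simp add: apply_bcontfun_sum cx)
      also have "\<dots> = real N * apply_bcontfun g x"
        using g(1,2)[of x] by (intro sum_clamp_steps) (auto simp: mult_left_le)
      finally show "apply_bcontfun (real N *\<^sub>R g) x = apply_bcontfun (\<Sum>j<N. c (Suc j)) x"
        by simp
    qed
    have regroup: "(\<Sum>j<N. H j) = (\<Sum>r<3. \<Sum>k<n. H (3 * k + r))" for H :: "nat \<Rightarrow> 'v"
      unfolding N_def
      by (induction n) (simp_all add: sum.distrib eval_nat_numeral algebra_simps)
    \<comment> \<open>The tents of one residue class are dominated by a telescoping sum of ramps.\<close>
    have tents: "norm (\<Sum>k<n. d (3 * k + r)) \<le> 1" for r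
    proof (rule norm_bound)
      fix x
      have "0 \<le> (\<Sum>k<n. apply_bcontfun (d (3 * k + r)) x)"
        by (intro sum_nonneg) (auto simp: d_def c_anti)
      moreover have "(\<Sum>k<n. apply_bcontfun (d (3 * k + r)) x)
          \<le> (\<Sum>k<n. apply_bcontfun (c (3 * k + r)) x - apply_bcontfun (c (3 * Suc k + r)) x)"
        by (intro sum_mono) (simp add: d_def c_anti)
      moreover have "\<dots> = apply_bcontfun (c r) x - apply_bcontfun (c (3 * n + r)) x"
        using sum_lessThan_telescope'[of "\<lambda>k. apply_bcontfun (c (3 * k + r)) x" n] by simp
      moreover have "\<dots> \<le> 1"
        using c01(2)[of r x] c01(1)[of "3 * n + r" x] by linarith
      ultimately show "norm (apply_bcontfun (\<Sum>k<n. d (3 * k + r)) x) \<le> 1"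
        by (simp add: apply_bcontfun_sum)
    qed
    have tents_Suc: "norm (\<Sum>k<n. d (Suc (3 * k + r))) \<le> 1" for r
      using tents[of "Suc r"] by simp
    have KK: "norm (F a b) \<le> K" if "norm a \<le> 1" "norm b \<le> 1" for a b
    proof -
      have "norm (F a b) \<le> norm a * norm b * K" by (rule K)
      also have "\<dots> \<le> 1 * K"
        by (intro mult_right_mono K mult_le_one that norm_ge_zero)
      finally show ?thesis by simp
    qed
    have up: "norm (\<Sum>k<n. F (d (Suc (3 * k + r))) (d (3 * k + r))) \<le> K" for r
    proof -
      have "(\<Sum>k<n. F (d (Suc (3 * k + r))) (d (3 * k + r)))
          = F (\<Sum>k<n. d (Suc (3 * k + r))) (\<Sum>k<n. d (3 * k + r))"
      proof (rule bilinear_sum_orthogonal[OF F, symmetric])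
        fix i j assume "i \<in> {..<n}" "j \<in> {..<n}" "i \<noteq> j"
        then consider "i < j" | "j < i" by linarith
        then show "F (d (Suc (3 * i + r))) (d (3 * j + r)) = 0"
          by cases (rule z3', simp, rule z3, simp)
      qed simp
      then show ?thesis using KK[OF tents_Suc tents] by simp
    qed
    have down: "norm (\<Sum>k<n. F (d (3 * k + r)) (d (Suc (3 * k + r)))) \<le> K" for r
    proof -
      have "(\<Sum>k<n. F (d (3 * k + r)) (d (Suc (3 * k + r))))
          = F (\<Sum>k<n. d (3 * k + r)) (\<Sum>k<n. d (Suc (3 * k + r)))"
      proof (rule bilinear_sum_orthogonal[OF F, symmetric])
        fix i j assume "i \<in> {..<n}" "j \<in> {..<n}" "i \<noteq> j"
        then consider "i < j" | "j < i" by linarith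
        then show "F (d (3 * i + r)) (d (Suc (3 * j + r))) = 0"
          by cases (rule z3', simp, rule z3, simp)
      qed simp
      then show ?thesis using KK[OF tents tents_Suc] by simp
    qed
    have "real N *\<^sub>R (F g ?one - F ?one g) = (\<Sum>j<N. F (c (Suc j)) ?one - F ?one (c (Suc j)))"
    proof -
      have "real N *\<^sub>R (F g ?one - F ?one g) = F (real N *\<^sub>R g) ?one - F ?one (real N *\<^sub>R g)"
        by (simp add: F.scaleR_left F.scaleR_right scaleR_diff_right)
      then show ?thesis
        by (simp add: gsum F.sum_left F.sum_right sum_subtractf)
    qed
    also have "\<dots> = (\<Sum>r<3. (\<Sum>k<n. F (d (Suc (3 * k + r))) (d (3 * k + r)))
        - (\<Sum>k<n. F (d (3 * k + r)) (d (Suc (3 * k + r)))))"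
      by (simp add: step regroup sum_subtractf)
    also have "norm \<dots> \<le> (\<Sum>r<3::nat. K + K)"
      by (intro sum_norm_le norm_triangle_le_diff add_mono up down)
    finally show ?thesis by (simp add: N_def)
  qed
  have "norm (F g ?one - F ?one g) \<le> 0"
  proof (rule ccontr)
    assume "\<not> ?thesis"
    then have pos: "norm (F g ?one - F ?one g) > 0" by simp
    then obtain n where n: "2 * K < real n * norm (F g ?one - F ?one g)"
      using reals_Archimedean3 by blast
    then have "n > 0" using K(1) by (cases n) auto
    with bound[of n] n show False by linarith
  qed
  then show ?thesis by simp
qed

section \<open>Complex scalars and the involution\<close>

lemma scaleC_one [simp]: "1 *\<^sub>C x = (x::'a::complex_normed_vector)"
  using scaleR_scaleC[of 1 x] by simp

lemma scaleC_zero_left [simp]: "0 *\<^sub>C x = (0::'a::complex_normed_vector)"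
  using scaleR_scaleC[of 0 x] by simp

lemma scaleC_minus_one: "(-1) *\<^sub>C x = - (x::'a::complex_normed_vector)"
  using scaleR_scaleC[of "-1" x] by simp

lemma scaleC_minus_left: "(- c) *\<^sub>C x = - (c *\<^sub>C (x::'a::complex_normed_vector))"
  using scaleC_scaleC[of "-1" c x] by (simp add: scaleC_minus_one)

lemma star_zero [simp]: "star 0 = (0::'a::c_star_algebra)"
  using star_add[of "0::'a" 0] by simp

lemma star_minus: "star (- x) = - star (x::'a::c_star_algebra)"
  using star_scaleC[of "-1" x] by (simp add: scaleC_minus_one)

lemma star_diff: "star (x - y) = star x - star (y::'a::c_star_algebra)"
  using star_add[of x "- y"] by (simp add: star_minus)

lemma star_scaleR: "star (r *\<^sub>R x) = r *\<^sub>R star (x::'a::c_star_algebra)"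
  by (simp add: scaleR_scaleC star_scaleC)

text \<open>The C*-identity gives \<open>\<parallel>y\<parallel>\<^sup>2 \<le> \<parallel>y\<^sup>*\<parallel> \<parallel>y\<parallel>\<close>, and \<open>y\<close> and \<open>y\<^sup>*\<close> can be exchanged.\<close>

lemma norm_star [simp]: "norm (star x) = norm (x::'a::c_star_algebra)"
proof -
  have *: "norm y \<le> norm (star y)" for y :: 'a
  proof (cases "y = 0")
    case False
    have "(norm y)\<^sup>2 \<le> norm (star y) * norm y"
      using norm_mult_ineq[of "star y" y] by (simp add: norm_star_mult_self)
    then show ?thesis using False by (simp add: power2_eq_square)
  qed simp
  show ?thesis using *[of x] *[of "star x"] by (simp add: star_star)
qed

lemma norm_mult_star_self: "norm (x * star x) = (norm (x::'a::c_star_algebra))\<^sup>2"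
  using norm_star_mult_self[of "star x"] by (simp add: star_star)

lemma bounded_linear_star: "bounded_linear (star :: 'a::c_star_algebra \<Rightarrow> 'a)"
  by (rule bounded_linear_intro[where K = 1]) (simp_all add: star_add star_scaleR)

section \<open>Polynomials on the unit circle\<close>

lemma coeff_le_sup_unit_circle:
  fixes p :: "complex poly"
  assumes "\<And>z. cmod z = 1 \<Longrightarrow> cmod (poly p z) \<le> B"
  shows "cmod (coeff p n) \<le> B"
proof -
  have higher: "(deriv ^^ k) (poly p) = poly ((pderiv ^^ k) p)" for k
    by (induction k) (auto simp: DERIV_imp_deriv[OF poly_DERIV])
  have "norm ((deriv ^^ n) (poly p) 0) \<le> fact n * B / 1 ^ n"
    by (rule Cauchy_inequality[where r = 1])
       (auto intro!: continuous_intros holomorphic_intros assms)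
  moreover have "(deriv ^^ n) (poly p) 0 = fact n * coeff p n"
    by (simp add: higher poly_0_coeff_0 coeff_higher_pderiv pochhammer_fact)
  ultimately show ?thesis
    by (simp add: norm_mult)
qed

text \<open>This is how the C*-identity turns an estimate with a factor linear in the degree into one with
  factor 1: passing to the power \<open>2 ^ k\<close> multiplies the degree by \<open>2 ^ k\<close> only.\<close>

lemma le_one_of_power_le_linear:
  fixes x :: real
  assumes "x \<ge> 0" and "\<And>k. x ^ 2 ^ k \<le> 2 ^ k * real d + 1"
  shows "x \<le> 1"
proof (rule ccontr)
  assume "\<not> x \<le> 1"
  then have x: "x > 1" by simp
  define c where "c = real d + 1"
  have c: "c > 0" by (simp add: c_def)
  have "filterlim (\<lambda>n::nat. x ^ n / (real n * c + 1)) at_top sequentially"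
    using x c by real_asymp
  then have "eventually (\<lambda>n::nat. x ^ n / (real n * c + 1) > 1) sequentially"
    by (auto simp: filterlim_at_top_dense)
  then obtain M where M: "\<And>n. n \<ge> M \<Longrightarrow> x ^ n / (real n * c + 1) > 1"
    by (auto simp: eventually_sequentially)
  have "x ^ (2 ^ M) / (real (2 ^ M) * c + 1) > 1"
    by (rule M) simp
  then have "x ^ (2 ^ M) > 2 ^ M * c + 1"
    using c by (simp add: less_divide_eq add_nonneg_pos)
  moreover have "2 ^ M * c + 1 \<ge> 2 ^ M * real d + 1"
    by (simp add: c_def)
  ultimately show False using assms(2)[of M] by linarith
qed

text \<open>On the unit circle this is the complex conjugate of \<open>p\<close>, multiplied by a power of \<open>z\<close> to make it
  a polynomial again; in the calculus below it stands for the adjoint of \<open>p(u)\<close>.\<close>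

definition conj_reflect :: "complex poly \<Rightarrow> complex poly" where
  "conj_reflect p = map_poly cnj (reflect_poly p)"

lemma degree_conj_reflect_le: "degree (conj_reflect p) \<le> degree p"
  unfolding conj_reflect_def
  by (rule order_trans[OF map_poly_degree_leq degree_reflect_poly_le])

lemma cnj_unit_circle: "cmod z = 1 \<Longrightarrow> cnj z = inverse z"
  using complex_div_cnj[of 1 z] by (simp add: divide_inverse)

lemma poly_conj_reflect:
  assumes "cmod z = 1"
  shows "poly (conj_reflect p) z = z ^ degree p * cnj (poly p z)"
proof -
  have "z \<noteq> 0" using assms by auto
  moreover have "cnj (inverse z) = z"
    using cnj_unit_circle[OF assms] by (metis complex_cnj_cnj)
  ultimately show ?thesis
    using assms by (simp add: conj_reflect_def poly_reflect_poly_nz cnj_unit_circle)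
qed

text \<open>On the circle \<open>cnj z = inverse z\<close>, so \<open>Re z\<close> and \<open>Im z\<close> are Laurent polynomials in \<open>z\<close>.\<close>

lemma real_polynomial_function_laurent:
  fixes g :: "complex \<Rightarrow> real"
  assumes "real_polynomial_function g"
  shows "\<exists>N p. \<forall>z. cmod z = 1 \<longrightarrow> complex_of_real (g z) = poly p z / z ^ N"
  using assms
proof (induction rule: real_polynomial_function.induct)
  case (linear g)
  interpret g: bounded_linear g by fact
  define a b where "a = complex_of_real (g 1)" and "b = complex_of_real (g \<i>)"
  have "complex_of_real (g z) = poly [:(a + \<i> * b) / 2, 0, (a - \<i> * b) / 2:] z / z ^ 1"
    if "cmod z = 1" for z
  proof -
    have "z \<noteq> 0" using that by auto
    have *: "(z + w) / 2 * a + \<i> * (w - z) / 2 * b = (a + \<i> * b) / 2 * w + (a - \<i> * b) / 2 * z" for w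
      by (simp add: field_simps)
    have "z = Re z *\<^sub>R 1 + Im z *\<^sub>R \<i>" by (simp add: complex_eq_iff)
    then have "g z = Re z * g 1 + Im z * g \<i>"
      by (metis g.add g.scaleR real_scaleR_def)
    then have "complex_of_real (g z) = complex_of_real (Re z) * a + complex_of_real (Im z) * b"
      by (simp add: a_def b_def)
    also have "complex_of_real (Re z) = (z + inverse z) / 2"
      using complex_add_cnj[of z] cnj_unit_circle[OF that] by simp
    also have "complex_of_real (Im z) = \<i> * (inverse z - z) / 2"
      unfolding cnj_unit_circle[OF that, symmetric] by (simp add: complex_eq_iff)
    also have "(z + inverse z) / 2 * a + \<i> * (inverse z - z) / 2 * b
        = (a + \<i> * b) / 2 * inverse z + (a - \<i> * b) / 2 * z"
      by (rule *)
    also have "\<dots> = poly [:(a + \<i> * b) / 2, 0, (a - \<i> * b) / 2:] z / z ^ 1"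
      using \<open>z \<noteq> 0\<close> by (simp add: field_simps)
    finally show ?thesis .
  qed
  then show ?case by blast
next
  case (const c)
  have "complex_of_real c = poly [:of_real c:] z / z ^ 0" for z by simp
  then show ?case by blast
next
  case (add f g)
  then obtain N p M q where *: "\<And>z. cmod z = 1 \<Longrightarrow> complex_of_real (f z) = poly p z / z ^ N"
      and **: "\<And>z. cmod z = 1 \<Longrightarrow> complex_of_real (g z) = poly q z / z ^ M" by blast
  have "complex_of_real (f z + g z) = poly (p * monom 1 M + q * monom 1 N) z / z ^ (N + M)"
    if "cmod z = 1" for z
  proof -
    have "z \<noteq> 0" using that by auto
    then show ?thesis
      by (simp add: *[OF that] **[OF that] poly_monom add_divide_distrib power_add)
  qed
  then show ?case by blast
next
  case (mult f g)
  then obtain N p M q where *: "\<And>z. cmod z = 1 \<Longrightarrow> complex_of_real (f z) = poly p z / z ^ N"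
      and **: "\<And>z. cmod z = 1 \<Longrightarrow> complex_of_real (g z) = poly q z / z ^ M" by blast
  have "complex_of_real (f z * g z) = poly (p * q) z / z ^ (N + M)"
    if "cmod z = 1" for z
    using *[OF that] **[OF that] by (simp add: power_add)
  then show ?case by blast
qed

lemma laurent_approximation:
  fixes f :: "complex \<Rightarrow>\<^sub>C real"
  assumes "e > 0"
  shows "\<exists>N p. \<forall>z. cmod z = 1 \<longrightarrow> cmod (of_real (apply_bcontfun f z) - poly p z / z ^ N) \<le> e"
proof -
  obtain g where g: "real_polynomial_function g"
      "\<And>z. z \<in> sphere 0 1 \<Longrightarrow> \<bar>apply_bcontfun f z - g z\<bar> < e"
    using Stone_Weierstrass_real_polynomial_function[of "sphere 0 1" "apply_bcontfun f" e] assms by auto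
  obtain N p where p: "\<And>z. cmod z = 1 \<Longrightarrow> complex_of_real (g z) = poly p z / z ^ N"
    using real_polynomial_function_laurent[OF g(1)] by blast
  have "cmod (of_real (apply_bcontfun f z) - poly p z / z ^ N) \<le> e" if "cmod z = 1" for z
    using g(2)[of z] that by (simp flip: p of_real_diff)
  then show ?thesis by blast
qed

definition laurent_near :: "(complex \<Rightarrow>\<^sub>C real) \<Rightarrow> nat \<Rightarrow> complex poly \<Rightarrow> real \<Rightarrow> bool" where
  "laurent_near f N p e \<longleftrightarrow>
     (\<forall>z. cmod z = 1 \<longrightarrow> cmod (of_real (apply_bcontfun f z) - poly p z / z ^ N) \<le> e)"

lemma laurent_near_null_seq:
  obtains r N p where "r \<longlonglongrightarrow> 0" "\<And>n. r n \<ge> 0" "\<And>n. laurent_near f (N n) (p n) (r n)"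
proof -
  define r where "r n = inverse (real (Suc n))" for n
  have "\<exists>N p. laurent_near f N p (r n)" for n
    unfolding laurent_near_def by (rule laurent_approximation) (simp add: r_def)
  then obtain N p where "\<And>n. laurent_near f (N n) (p n) (r n)" by metis
  moreover have "r \<longlonglongrightarrow> 0" unfolding r_def by (rule LIMSEQ_inverse_real_of_nat)
  ultimately show thesis by (intro that) (auto simp: r_def)
qed

lemma laurent_near_add:
  assumes "laurent_near f N p d" "laurent_near g M q e"
  shows "laurent_near (f + g) (N + M) (monom 1 M * p + monom 1 N * q) (d + e)"
  unfolding laurent_near_def
proof (intro allI impI)
  fix z assume z: "cmod z = 1"
  then have "z \<noteq> 0" by auto
  then have "poly (monom 1 M * p + monom 1 N * q) z / z ^ (N + M) = poly p z / z ^ N + poly q z / z ^ M"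
    by (simp add: poly_monom field_simps power_add)
  then have "of_real (apply_bcontfun (f + g) z) - poly (monom 1 M * p + monom 1 N * q) z / z ^ (N + M)
      = (of_real (apply_bcontfun f z) - poly p z / z ^ N) + (of_real (apply_bcontfun g z) - poly q z / z ^ M)"
    by simp
  also have "cmod \<dots> \<le> d + e"
    using assms z by (intro norm_triangle_le add_mono) (auto simp: laurent_near_def)
  finally show "cmod (of_real (apply_bcontfun (f + g) z)
      - poly (monom 1 M * p + monom 1 N * q) z / z ^ (N + M)) \<le> d + e" .
qed

text \<open>The sum of \<open>s ^ i\<close> for \<open>i \<le> n\<close> has \<open>n + 1\<close> terms, each at least \<open>s ^ n\<close>, and telescopes
  when multiplied by \<open>1 - s\<close>.\<close>

lemma power_times_one_minus_le:
  fixes s :: real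
  assumes "0 \<le> s" "s \<le> 1"
  shows "s ^ n * (1 - s) \<le> 1 / (real n + 1)"
proof -
  have "(real n + 1) * s ^ n * (1 - s) = (\<Sum>i\<le>n. s ^ n) * (1 - s)"
    by simp
  also have "\<dots> \<le> (\<Sum>i\<le>n. s ^ i) * (1 - s)"
    using assms by (intro mult_right_mono sum_mono power_decreasing) auto
  also have "\<dots> = 1 - s ^ Suc n"
    using one_diff_power_eq[of s "Suc n"] by (simp add: lessThan_Suc_atMost mult.commute)
  also have "\<dots> \<le> 1" using assms by simp
  finally show ?thesis by (simp add: field_simps)
qed

text \<open>The powers of \<open>(1 + z) / 2\<close> are 1 at \<open>z = 1\<close> and decay elsewhere on the circle, so after
  multiplication with \<open>z - 1\<close> they tend to 0 uniformly. With \<open>s = \<bar>(1 + z) / 2\<bar>\<^sup>2\<close> the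
  parallelogram law gives \<open>\<bar>z - 1\<bar>\<^sup>2 = 4 (1 - s)\<close>.\<close>

lemma half_plus_power_bound:
  assumes "cmod z = 1"
  shows "cmod (poly ([:1/2, 1/2:] ^ n) z * (z - 1)) \<le> 2 / sqrt (real n + 1)"
proof -
  define s where "s = (cmod ((1 + z) / 2))\<^sup>2"
  have z: "(Re z)\<^sup>2 + (Im z)\<^sup>2 = 1"
    using assms by (simp add: cmod_def)
  have s: "s = (1 + Re z) / 2"
  proof -
    have "s = ((1 + Re z)\<^sup>2 + (Im z)\<^sup>2) / 4"
      by (simp add: s_def norm_divide power_divide cmod_power2)
    also have "\<dots> = (1 + Re z) / 2" using z by (simp add: power2_eq_square field_simps)
    finally show ?thesis .
  qed
  have z1: "(cmod (z - 1))\<^sup>2 = 4 * (1 - s)"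
  proof -
    have "(cmod (z - 1))\<^sup>2 = (Re z - 1)\<^sup>2 + (Im z)\<^sup>2" by (simp add: cmod_power2)
    also have "\<dots> = 4 * (1 - s)" using z by (simp add: s power2_eq_square algebra_simps)
    finally show ?thesis .
  qed
  have s01: "0 \<le> s" "s \<le> 1"
    using s abs_Re_le_cmod[of z] assms by (auto simp: s_def)
  have "(cmod (poly ([:1/2, 1/2:] ^ n) z * (z - 1)))\<^sup>2 = s ^ n * (4 * (1 - s))"
    by (simp add: norm_mult norm_power power_mult_distrib z1 s_def add_divide_distrib
        flip: power_mult) (simp add: mult.commute)
  also have "\<dots> = 4 * (s ^ n * (1 - s))" by simp
  also have "\<dots> \<le> 4 * (1 / (real n + 1))"
    by (intro mult_left_mono power_times_one_minus_le s01) simp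
  also have "\<dots> = (2 / sqrt (real n + 1))\<^sup>2"
    by (simp add: power_divide)
  finally show ?thesis
    by (rule power2_le_imp_le) simp
qed

section \<open>Polynomial calculus of a unitary in the unitization\<close>

text \<open>The two equations say that \<open>u = 1 + v\<close> satisfies \<open>u\<^sup>* u = 1 = u u\<^sup>*\<close> in the unitization.\<close>

locale quasi_unitary =
  fixes v :: "'a::c_star_algebra"
  assumes v_star_v: "v + star v + star v * v = 0"
    and v_v_star: "v + star v + v * star v = 0"
begin

text \<open>Right multiplication by \<open>u\<close> and by its inverse \<open>u\<^sup>*\<close>. They are mutually inverse isometries.\<close>

definition R :: "'a \<Rightarrow> 'a" where "R x = x + x * v"
definition R' :: "'a \<Rightarrow> 'a" where "R' x = x + x * star v"

text \<open>The element \<open>x p(u)\<close>.\<close>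

definition poly_act :: "complex poly \<Rightarrow> 'a \<Rightarrow> 'a" where
  "poly_act p x = (\<Sum>n\<le>degree p. coeff p n *\<^sub>C (R ^^ n) x)"

lemma R_linear: "R (x + y) = R x + R y" "R (c *\<^sub>C x) = c *\<^sub>C R x" "R 0 = 0"
  by (simp_all add: R_def algebra_simps scaleC_add_right mult_scaleC_left)

lemma R'_linear: "R' (x + y) = R' x + R' y" "R' (c *\<^sub>C x) = c *\<^sub>C R' x" "R' 0 = 0"
  by (simp_all add: R'_def algebra_simps scaleC_add_right mult_scaleC_left)

lemma R_sum: "R (sum f I) = (\<Sum>i\<in>I. R (f i))"
  by (induction I rule: infinite_finite_induct) (auto simp: R_linear)

lemma R'_R [simp]: "R' (R x) = x"
proof -
  have "R' (R x) = x + x * (v + star v + v * star v)"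
    by (simp add: R_def R'_def algebra_simps)
  then show ?thesis by (simp add: v_v_star)
qed

lemma R_R' [simp]: "R (R' x) = x"
proof -
  have "R (R' x) = x + x * (v + star v + star v * v)"
    by (simp add: R_def R'_def algebra_simps)
  then show ?thesis by (simp add: v_star_v)
qed

lemma R_mult_star: "R x * star y = x * star (R' y)"
  by (simp add: R_def R'_def star_add star_mult star_star algebra_simps)

lemma norm_R [simp]: "norm (R x) = norm x"
proof -
  have "(norm (R x))\<^sup>2 = (norm x)\<^sup>2"
    by (simp add: R_mult_star flip: norm_mult_star_self)
  then show ?thesis by simp
qed

lemma norm_R' [simp]: "norm (R' x) = norm x"
  using norm_R[of "R' x"] by simp

lemma norm_R_power [simp]: "norm ((R ^^ n) x) = norm x"
  by (induction n) auto

lemma norm_R'_power [simp]: "norm ((R' ^^ n) x) = norm x"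
  by (induction n) auto

lemma R_power_mult_star: "(R ^^ n) x * star y = x * star ((R' ^^ n) y)"
  by (induction n arbitrary: y) (simp_all add: R_mult_star flip: funpow_swap1)

lemma poly_act_upto:
  assumes "degree p \<le> m"
  shows "poly_act p x = (\<Sum>n\<le>m. coeff p n *\<^sub>C (R ^^ n) x)"
  unfolding poly_act_def using assms
  by (intro sum.mono_neutral_left) (auto simp: coeff_eq_0)

lemma poly_act_0 [simp]: "poly_act 0 x = 0"
  by (simp add: poly_act_def)

lemma poly_act_pCons: "poly_act (pCons c p) x = c *\<^sub>C x + R (poly_act p x)"
proof -
  have "poly_act (pCons c p) x = (\<Sum>n\<le>Suc (degree p). coeff (pCons c p) n *\<^sub>C (R ^^ n) x)"
    by (rule poly_act_upto) (simp add: degree_pCons_le)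
  also have "\<dots> = c *\<^sub>C x + (\<Sum>n\<le>degree p. coeff p n *\<^sub>C R ((R ^^ n) x))"
    by (subst sum.atMost_Suc_shift) simp
  also have "\<dots> = c *\<^sub>C x + R (poly_act p x)"
    by (simp add: poly_act_def R_sum R_linear)
  finally show ?thesis .
qed

lemma poly_act_1 [simp]: "poly_act 1 x = x"
  by (simp add: one_pCons poly_act_pCons R_linear)

lemma poly_act_add: "poly_act (p + q) x = poly_act p x + poly_act q x"
proof (induction p arbitrary: q)
  case (pCons c p)
  obtain d r where q: "q = pCons d r" by (rule pCons_cases)
  show ?case using pCons.IH[of r]
    by (simp add: q poly_act_pCons R_linear scaleC_add_left)
qed simp

lemma poly_act_smult: "poly_act (smult c p) x = c *\<^sub>C poly_act p x"
  by (induction p) (simp_all add: poly_act_pCons R_linear scaleC_add_right scaleC_scaleC scaleC_zero_right)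

lemma poly_act_diff: "poly_act (p - q) x = poly_act p x - poly_act q x"
proof -
  have "p - q = p + smult (-1) q" by simp
  then show ?thesis by (simp only: poly_act_add poly_act_smult scaleC_minus_one) simp
qed

lemma poly_act_mult: "poly_act (p * q) x = poly_act p (poly_act q x)"
  by (induction p) (simp_all add: poly_act_pCons poly_act_add poly_act_smult R_linear)

lemma poly_act_zero_right [simp]: "poly_act p 0 = 0"
  by (induction p) (simp_all add: poly_act_pCons R_linear scaleC_zero_right)

lemma poly_act_mult_left: "poly_act p (y * x) = y * poly_act p x"
proof -
  have R: "R (y * x) = y * R x" for x by (simp add: R_def algebra_simps)
  show ?thesis
    by (induction p) (simp_all add: poly_act_pCons R ring_distribs mult_scaleC_right)
qed

lemma poly_act_monom: "poly_act (monom c n) x = c *\<^sub>C (R ^^ n) x"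
  by (induction n) (simp_all add: monom_0 monom_Suc poly_act_pCons R_linear)

lemma poly_act_R: "poly_act p (R x) = R (poly_act p x)"
  by (induction p) (simp_all add: poly_act_pCons R_linear)

lemma poly_act_R': "poly_act p (R' x) = R' (poly_act p x)"
  using poly_act_R[of p "R' x"] by (metis R'_R R_R')

lemma poly_act_R'_power: "poly_act p ((R' ^^ n) x) = (R' ^^ n) (poly_act p x)"
  by (induction n) (simp_all add: poly_act_R')

lemma R'_power_R_power: "(R' ^^ n) ((R ^^ n) x) = x"
  by (induction n) (simp_all add: funpow_swap1[of R'])

lemma R'_power_add: "(R' ^^ n) (x + y) = (R' ^^ n) x + (R' ^^ n) y"
  by (induction n) (simp_all add: R'_linear)

lemma R'_power_diff: "(R' ^^ n) (x - y) = (R' ^^ n) x - (R' ^^ n) y"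
  using R'_power_add[of n "x - y" y] by simp

lemma R'_power_scaleC: "(R' ^^ n) (c *\<^sub>C x) = c *\<^sub>C (R' ^^ n) x"
  by (induction n) (simp_all add: R'_linear)

text \<open>This is \<open>(x p(u)) y\<^sup>* = x (y p(u)\<^sup>*)\<^sup>*\<close>; the power of \<open>R'\<close> removes the power of \<open>z\<close> by which
  \<open>conj_reflect p\<close> differs from the conjugate of \<open>p\<close>.\<close>

lemma poly_act_mult_star:
  "poly_act p x * star y = x * star ((R' ^^ degree p) (poly_act (conj_reflect p) y))"
proof (induction p arbitrary: y)
  case 0
  show ?case by (simp add: conj_reflect_def)
next
  case (pCons c p)
  show ?case
  proof (cases "p = 0")
    case True
    then show ?thesis
      by (simp add: conj_reflect_def poly_act_pCons R_linear star_scaleC mult_scaleC_left mult_scaleC_right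
          map_poly_pCons)
  next
    case False
    have refl: "conj_reflect (pCons c p) = monom (cnj c) (Suc (degree p)) + conj_reflect p"
      using False
      by (intro poly_eqI)
         (simp add: conj_reflect_def reflect_poly_pCons' coeff_map_poly add.commute)
    have "poly_act (pCons c p) x * star y
        = x * star (cnj c *\<^sub>C y) + x * star ((R' ^^ degree p) (poly_act (conj_reflect p) (R' y)))"
      by (simp add: poly_act_pCons ring_distribs mult_scaleC_left mult_scaleC_right star_scaleC
          R_mult_star pCons.IH)
    also have "(R' ^^ degree p) (poly_act (conj_reflect p) (R' y))
        = (R' ^^ degree (pCons c p)) (poly_act (conj_reflect p) y)"
      using False by (simp add: poly_act_R' funpow_swap1)
    also have "cnj c *\<^sub>C y
        = (R' ^^ degree (pCons c p)) (poly_act (monom (cnj c) (Suc (degree p))) y)"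
      by (simp only: poly_act_monom R'_power_scaleC degree_pCons_eq[OF False] R'_power_R_power)
    finally show ?thesis
      by (simp only: refl poly_act_add R'_power_add star_add ring_distribs)
  qed
qed

lemma norm_poly_act_le_coeffs:
  assumes "\<And>z. cmod z = 1 \<Longrightarrow> cmod (poly p z) \<le> B"
  shows "norm (poly_act p x) \<le> norm x * ((real (degree p) + 1) * B)"
proof -
  have "norm (poly_act p x) \<le> (\<Sum>n\<le>degree p. B * norm x)"
    unfolding poly_act_def
    by (intro sum_norm_le) (auto simp: norm_scaleC intro!: mult_right_mono coeff_le_sup_unit_circle assms)
  then show ?thesis by (simp add: algebra_simps)
qed

text \<open>The polynomial \<open>conj_reflect p * p\<close> has modulus \<open>\<bar>p\<bar>\<^sup>2\<close> on the circle, so this is the inequality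
  \<open>\<parallel>x p(u)\<parallel>\<^sup>2 \<le> \<parallel>x\<parallel> \<parallel>x \<bar>p\<bar>\<^sup>2(u)\<parallel>\<close>, and it can be iterated.\<close>

lemma norm_poly_act_square_le: "(norm (poly_act p x))\<^sup>2 \<le> norm x * norm (poly_act (conj_reflect p * p) x)"
proof -
  have "(norm (poly_act p x))\<^sup>2 = norm (x * star ((R' ^^ degree p) (poly_act (conj_reflect p * p) x)))"
    by (simp only: poly_act_mult_star poly_act_mult flip: norm_mult_star_self)
  also have "\<dots> \<le> norm x * norm (star ((R' ^^ degree p) (poly_act (conj_reflect p * p) x)))"
    by (rule norm_mult_ineq)
  finally show ?thesis by simp
qed

text \<open>Each application of \<open>norm_poly_act_square_le\<close> doubles the degree and squares the supremum; the
  coefficient bound at the end costs a factor of one more than the degree.\<close>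

lemma norm_poly_act_power_le:
  assumes "\<And>z. cmod z = 1 \<Longrightarrow> cmod (poly p z) \<le> B"
  shows "norm (poly_act p x) ^ 2 ^ k \<le> norm x ^ 2 ^ k * ((2 ^ k * real (degree p) + 1) * B ^ 2 ^ k)"
  using assms
proof (induction k arbitrary: p B)
  case 0
  then show ?case using norm_poly_act_le_coeffs[of p B x] by simp
next
  case (Suc k)
  let ?q = "conj_reflect p * p"
  have B: "B \<ge> 0" using Suc.prems[of 1] norm_ge_zero order_trans by (metis norm_one)
  have "cmod (poly ?q z) \<le> B\<^sup>2" if "cmod z = 1" for z
  proof -
    have "cmod (poly ?q z) = cmod (poly p z) * cmod (poly p z)"
      using that by (simp add: poly_conj_reflect norm_mult norm_power)
    also have "\<dots> \<le> B\<^sup>2"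
      unfolding power2_eq_square using Suc.prems[OF that] B by (intro mult_mono) auto
    finally show ?thesis .
  qed
  note IH = Suc.IH[OF this]
  have deg: "degree ?q \<le> 2 * degree p"
    using degree_mult_le[of "conj_reflect p" p] degree_conj_reflect_le[of p] by linarith
  have "norm (poly_act p x) ^ 2 ^ Suc k = ((norm (poly_act p x))\<^sup>2) ^ 2 ^ k"
    by (simp add: power_mult)
  also have "\<dots> \<le> (norm x * norm (poly_act ?q x)) ^ 2 ^ k"
    by (intro power_mono norm_poly_act_square_le) simp
  also have "\<dots> = norm x ^ 2 ^ k * norm (poly_act ?q x) ^ 2 ^ k"
    by (simp add: power_mult_distrib)
  also have "\<dots> \<le> norm x ^ 2 ^ k * (norm x ^ 2 ^ k * ((2 ^ k * real (degree ?q) + 1) * (B\<^sup>2) ^ 2 ^ k))"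
    by (intro mult_left_mono IH) auto
  also have "\<dots> \<le> norm x ^ 2 ^ k * (norm x ^ 2 ^ k * ((2 ^ k * (2 * real (degree p)) + 1) * (B\<^sup>2) ^ 2 ^ k))"
    using deg B by (intro mult_left_mono mult_right_mono add_right_mono) (auto simp flip: of_nat_mult)
  also have "\<dots> = norm x ^ 2 ^ Suc k * ((2 ^ Suc k * real (degree p) + 1) * B ^ 2 ^ Suc k)"
  proof -
    have "(B\<^sup>2) ^ 2 ^ k = B ^ 2 ^ Suc k" "norm x ^ 2 ^ Suc k = norm x ^ 2 ^ k * norm x ^ 2 ^ k"
      by (simp_all add: mult_2 power_add flip: power_mult)
    then show ?thesis by (simp add: mult.assoc)
  qed
  finally show ?case .
qed

text \<open>The bound \<open>B\<close> may be 0, hence the detour through a slightly larger positive bound.\<close>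

lemma norm_poly_act_le:
  assumes "\<And>z. cmod z = 1 \<Longrightarrow> cmod (poly p z) \<le> B"
  shows "norm (poly_act p x) \<le> norm x * B"
proof (rule field_le_epsilon)
  fix e :: real assume e: "e > 0"
  show "norm (poly_act p x) \<le> norm x * B + e"
  proof (cases "x = 0")
    case True
    then show ?thesis using e by simp
  next
    case False
    have B: "B \<ge> 0" using assms[of 1] norm_ge_zero order_trans by (metis norm_one)
    define C where "C = B + e / norm x"
    have C: "C > 0" using B e False by (simp add: C_def add_nonneg_pos)
    have "cmod (poly p z) \<le> C" if "cmod z = 1" for z
      using assms[OF that] e False by (simp add: C_def add_increasing2)
    note pow = norm_poly_act_power_le[of p C x, OF this]
    have "(norm (poly_act p x) / (norm x * C)) ^ 2 ^ k \<le> 2 ^ k * real (degree p) + 1" for k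
      using pow[of k] False C
      by (simp add: power_divide power_mult_distrib divide_le_eq mult.commute mult.left_commute)
    then have "norm (poly_act p x) / (norm x * C) \<le> 1"
      using C by (intro le_one_of_power_le_linear) auto
    then have "norm (poly_act p x) \<le> norm x * C"
      using False C by (simp add: divide_le_eq)
    also have "\<dots> = norm x * B + e"
      using False by (simp add: C_def algebra_simps)
    finally show ?thesis .
  qed
qed

section \<open>Continuous functional calculus\<close>

text \<open>The element \<open>x q(u)\<close> for the Laurent polynomial \<open>q(z) = p(z) / z ^ N\<close>.\<close>

definition laurent_act :: "nat \<Rightarrow> complex poly \<Rightarrow> 'a \<Rightarrow> 'a" where
  "laurent_act N p x = (R' ^^ N) (poly_act p x)"

text \<open>Two Laurent polynomials are added and subtracted by bringing them to a common denominator.\<close>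

lemma laurent_act_expand: "laurent_act N p x = laurent_act (N + M) (monom 1 M * p) x"
  by (simp add: laurent_act_def poly_act_mult poly_act_monom funpow_add R'_power_R_power)

lemma laurent_act_add: "laurent_act N p x + laurent_act M q x = laurent_act (N + M) (monom 1 M * p + monom 1 N * q) x"
  unfolding laurent_act_expand[of N p x M] laurent_act_expand[of M q x N] add.commute[of M N]
  by (simp add: laurent_act_def poly_act_add R'_power_add)

lemma laurent_act_diff: "laurent_act N p x - laurent_act M q x = laurent_act (N + M) (monom 1 M * p - monom 1 N * q) x"
  unfolding laurent_act_expand[of N p x M] laurent_act_expand[of M q x N] add.commute[of M N]
  by (simp add: laurent_act_def poly_act_diff R'_power_diff)

lemma norm_laurent_act_le:
  assumes "\<And>z. cmod z = 1 \<Longrightarrow> cmod (poly p z / z ^ N) \<le> B"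
  shows "norm (laurent_act N p x) \<le> norm x * B"
  using assms by (auto simp: laurent_act_def norm_divide norm_power intro!: norm_poly_act_le)

lemma norm_laurent_act_diff_le:
  assumes "\<And>z. cmod z = 1 \<Longrightarrow> cmod (poly p z / z ^ N - poly q z / z ^ M) \<le> B"
  shows "norm (laurent_act N p x - laurent_act M q x) \<le> norm x * B"
  unfolding laurent_act_diff
proof (rule norm_laurent_act_le)
  fix z assume z: "cmod z = 1"
  then have "z \<noteq> 0" by auto
  then have "poly (monom 1 M * p - monom 1 N * q) z / z ^ (N + M) = poly p z / z ^ N - poly q z / z ^ M"
    by (simp add: poly_monom field_simps power_add)
  then show "cmod (poly (monom 1 M * p - monom 1 N * q) z / z ^ (N + M)) \<le> B"
    using assms[OF z] by simp
qed

lemma norm_laurent_act_diff_near: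
  assumes "laurent_near f N p d" "laurent_near f M q e"
  shows "norm (laurent_act N p x - laurent_act M q x) \<le> norm x * (d + e)"
proof (rule norm_laurent_act_diff_le)
  fix z assume z: "cmod z = 1"
  show "cmod (poly p z / z ^ N - poly q z / z ^ M) \<le> d + e"
    using assms z norm_triangle_ineq4[of "of_real (apply_bcontfun f z) - poly q z / z ^ M"
        "of_real (apply_bcontfun f z) - poly p z / z ^ N"]
    unfolding laurent_near_def by fastforce
qed

text \<open>Approximate \<open>f\<close> uniformly by Laurent polynomials: their actions form a Cauchy sequence by the
  supremum estimate, and the limit does not depend on the approximation.\<close>

lemma cont_act_exists:
  "\<exists>y. \<forall>N p e. laurent_near f N p e \<longrightarrow> norm (y - laurent_act N p x) \<le> norm x * e"
proof -
  obtain r N p where r0: "r \<longlonglongrightarrow> 0" "\<And>n. r n \<ge> 0" and Np: "\<And>n. laurent_near f (N n) (p n) (r n)"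
    by (rule laurent_near_null_seq[of f]) (rule that)
  define Y where "Y n = laurent_act (N n) (p n) x" for n
  have "Cauchy Y"
  proof (rule CauchyI)
    fix e :: real assume e: "e > 0"
    define d where "d = e / (2 * (norm x + 1))"
    have d: "d > 0" using e by (simp add: d_def add_nonneg_pos)
    then obtain K where K: "\<And>n. n \<ge> K \<Longrightarrow> \<bar>r n\<bar> < d"
      using r0 unfolding LIMSEQ_def dist_real_def by fastforce
    have "norm (Y m - Y n) < e" if "m \<ge> K" "n \<ge> K" for m n
    proof -
      have "norm (Y m - Y n) \<le> norm x * (r m + r n)"
        unfolding Y_def by (rule norm_laurent_act_diff_near[OF Np Np])
      also have "\<dots> \<le> norm x * (d + d)"
        using K[OF that(1)] K[OF that(2)] by (intro mult_left_mono add_mono) auto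
      also have "\<dots> < (norm x + 1) * (d + d)"
        using d by simp
      also have "\<dots> = e"
        proof -
        have "norm x + 1 \<noteq> 0" using norm_ge_zero[of x] by linarith
        then show ?thesis unfolding d_def by (simp add: divide_simps)
      qed
      finally show ?thesis .
    qed
    then show "\<exists>M. \<forall>m\<ge>M. \<forall>n\<ge>M. norm (Y m - Y n) < e" by blast
  qed
  then obtain y where y: "Y \<longlonglongrightarrow> y"
    using Cauchy_convergent convergent_def by blast
  have "norm (y - laurent_act M q x) \<le> norm x * e" if "laurent_near f M q e" for M q e
  proof (rule tendsto_le[OF sequentially_bot])
    show "(\<lambda>n. norm x * (r n + e)) \<longlonglongrightarrow> norm x * e"
      using r0 by (auto intro!: tendsto_eq_intros)
    show "(\<lambda>n. norm (Y n - laurent_act M q x)) \<longlonglongrightarrow> norm (y - laurent_act M q x)"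
      using y by (intro tendsto_intros)
    show "\<forall>\<^sub>F n in sequentially. norm (Y n - laurent_act M q x) \<le> norm x * (r n + e)"
      unfolding Y_def by (intro always_eventually allI norm_laurent_act_diff_near[OF Np that])
  qed
  then show ?thesis by blast
qed

text \<open>The element \<open>x f(u)\<close>. The defining property determines it uniquely, since there are
  approximations with arbitrarily small \<open>e\<close>. The function \<open>f\<close> enters only through its values on the
  unit circle; it is defined on the whole plane so that the functions form a normed space.\<close>

definition cont_act :: "(complex \<Rightarrow>\<^sub>C real) \<Rightarrow> 'a \<Rightarrow> 'a" where
  "cont_act f x = (SOME y. \<forall>N p e. laurent_near f N p e \<longrightarrow> norm (y - laurent_act N p x) \<le> norm x * e)"

lemma cont_act_near:
  assumes "laurent_near f N p e"
  shows "norm (cont_act f x - laurent_act N p x) \<le> norm x * e"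
  using someI_ex[OF cont_act_exists[of f x]] assms unfolding cont_act_def by blast

lemma cont_act_laurent:
  assumes "\<And>z. cmod z = 1 \<Longrightarrow> complex_of_real (apply_bcontfun f z) = poly p z / z ^ N"
  shows "cont_act f x = laurent_act N p x"
  using cont_act_near[of f N p 0 x] assms by (simp add: laurent_near_def)

lemma laurent_near_seq:
  obtains r N p where "r \<longlonglongrightarrow> 0" "\<And>n. r n \<ge> 0" "\<And>n. laurent_near f (N n) (p n) (r n)"
    "\<And>x. (\<lambda>n. laurent_act (N n) (p n) x) \<longlonglongrightarrow> cont_act f x"
proof -
  obtain r N p where r0: "r \<longlonglongrightarrow> 0" "\<And>n. r n \<ge> 0" and Np: "\<And>n. laurent_near f (N n) (p n) (r n)"
    by (rule laurent_near_null_seq[of f]) (rule that)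
  have "(\<lambda>n. laurent_act (N n) (p n) x) \<longlonglongrightarrow> cont_act f x" for x
  proof (rule Lim_null[THEN iffD2], rule Lim_null_comparison)
    show "\<forall>\<^sub>F n in sequentially. norm (laurent_act (N n) (p n) x - cont_act f x) \<le> norm x * r n"
      using cont_act_near[OF Np, of x] by (auto simp: norm_minus_commute)
    show "(\<lambda>n. norm x * r n) \<longlonglongrightarrow> 0"
      by (rule tendsto_mult_right_zero[OF r0(1)])
  qed
  with r0 Np show thesis by (rule that)
qed

lemma cont_act_add: "cont_act (f + g) x = cont_act f x + cont_act g x"
proof -
  obtain r N p where r0: "r \<longlonglongrightarrow> 0" "\<And>n. r n \<ge> 0"
    and Np: "\<And>n. laurent_near f (N n) (p n) (r n)"
    "\<And>x. (\<lambda>n. laurent_act (N n) (p n) x) \<longlonglongrightarrow> cont_act f x" by (rule laurent_near_seq[of f]) (rule that)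
  obtain s M q where s0: "s \<longlonglongrightarrow> 0" "\<And>n. s n \<ge> 0"
    and Mq: "\<And>n. laurent_near g (M n) (q n) (s n)"
    "\<And>x. (\<lambda>n. laurent_act (M n) (q n) x) \<longlonglongrightarrow> cont_act g x" by (rule laurent_near_seq[of g]) (rule that)
  let ?s = "\<lambda>n. laurent_act (N n) (p n) x + laurent_act (M n) (q n) x"
  have "?s \<longlonglongrightarrow> cont_act f x + cont_act g x"
    by (intro tendsto_add Np Mq)
  moreover have "?s \<longlonglongrightarrow> cont_act (f + g) x"
  proof (rule Lim_null[THEN iffD2], rule Lim_null_comparison)
    show "\<forall>\<^sub>F n in sequentially. norm (?s n - cont_act (f + g) x)
        \<le> norm x * (r n + s n)"
      by (intro always_eventually allI)
         (metis laurent_act_add norm_minus_commute cont_act_near laurent_near_add Np(1) Mq(1))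
    show "(\<lambda>n. norm x * (r n + s n)) \<longlonglongrightarrow> 0"
      using r0 s0 by (auto intro!: tendsto_eq_intros)
  qed
  ultimately show ?thesis using LIMSEQ_unique by blast
qed

lemma norm_cont_act_le: "norm (cont_act f x) \<le> norm x * norm f"
proof -
  obtain r N p where r0: "r \<longlonglongrightarrow> 0" "\<And>n. r n \<ge> 0"
    and Np: "\<And>n. laurent_near f (N n) (p n) (r n)"
    "\<And>x. (\<lambda>n. laurent_act (N n) (p n) x) \<longlonglongrightarrow> cont_act f x" by (rule laurent_near_seq[of f]) (rule that)
  show ?thesis
  proof (rule tendsto_le[OF sequentially_bot])
    show "(\<lambda>n. norm x * (norm f + r n)) \<longlonglongrightarrow> norm x * norm f"
      using r0 by (auto intro!: tendsto_eq_intros)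
    show "(\<lambda>n. norm (laurent_act (N n) (p n) x)) \<longlonglongrightarrow> norm (cont_act f x)"
      by (intro tendsto_norm Np)
    show "\<forall>\<^sub>F n in sequentially. norm (laurent_act (N n) (p n) x) \<le> norm x * (norm f + r n)"
    proof (intro always_eventually allI norm_laurent_act_le)
      fix n z assume z: "cmod z = 1"
      have "cmod (poly (p n) z / z ^ N n) \<le> cmod (of_real (apply_bcontfun f z))
          + cmod (of_real (apply_bcontfun f z) - poly (p n) z / z ^ N n)"
        by (metis norm_triangle_sub norm_minus_commute)
      also have "\<dots> \<le> norm f + r n"
        using Np(1)[of n] z norm_bounded[of f z]
        by (intro add_mono) (auto simp: laurent_near_def)
      finally show "cmod (poly (p n) z / z ^ N n) \<le> norm f + r n" .
    qed
  qed
qed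

lemma cont_act_scaleR: "cont_act (t *\<^sub>R f) x = t *\<^sub>R cont_act f x"
proof -
  obtain r N p where r0: "r \<longlonglongrightarrow> 0" "\<And>n. r n \<ge> 0"
    and Np: "\<And>n. laurent_near f (N n) (p n) (r n)"
    "\<And>x. (\<lambda>n. laurent_act (N n) (p n) x) \<longlonglongrightarrow> cont_act f x" by (rule laurent_near_seq[of f]) (rule that)
  have near: "laurent_near (t *\<^sub>R f) (N n) (smult (of_real t) (p n)) (\<bar>t\<bar> * r n)" for n
    unfolding laurent_near_def
  proof (intro allI impI)
    fix z assume z: "cmod z = 1"
    have "of_real (apply_bcontfun (t *\<^sub>R f) z) - poly (smult (of_real t) (p n)) z / z ^ N n
        = of_real t * (of_real (apply_bcontfun f z) - poly (p n) z / z ^ N n)"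
      by (simp add: algebra_simps)
    also have "cmod \<dots> \<le> \<bar>t\<bar> * r n"
      unfolding norm_mult using Np(1)[of n] z
      by (intro mult_mono) (auto simp: laurent_near_def)
    finally show "cmod (of_real (apply_bcontfun (t *\<^sub>R f) z) - poly (smult (of_real t) (p n)) z / z ^ N n)
        \<le> \<bar>t\<bar> * r n" .
  qed
  let ?s = "\<lambda>n. t *\<^sub>R laurent_act (N n) (p n) x"
  have "?s \<longlonglongrightarrow> t *\<^sub>R cont_act f x"
    by (intro tendsto_intros Np)
  moreover have "?s \<longlonglongrightarrow> cont_act (t *\<^sub>R f) x"
  proof (rule Lim_null[THEN iffD2], rule Lim_null_comparison)
    have "?s n = laurent_act (N n) (smult (of_real t) (p n)) x" for n
      by (simp add: laurent_act_def poly_act_smult R'_power_scaleC scaleR_scaleC)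
    then show "\<forall>\<^sub>F n in sequentially. norm (?s n - cont_act (t *\<^sub>R f) x)
        \<le> norm x * (\<bar>t\<bar> * r n)"
      using cont_act_near[OF near, of x] by (simp add: norm_minus_commute)
    show "(\<lambda>n. norm x * (\<bar>t\<bar> * r n)) \<longlonglongrightarrow> 0"
      using r0 by (auto intro!: tendsto_eq_intros)
  qed
  ultimately show ?thesis using LIMSEQ_unique by blast
qed

lemma bounded_linear_cont_act: "bounded_linear (\<lambda>f. cont_act f x)"
  by (rule bounded_linear_intro[where K = "norm x"])
     (use norm_cont_act_le in \<open>auto simp: cont_act_add cont_act_scaleR mult.commute\<close>)

text \<open>This is the supremum estimate for the product \<open>p(u) q(u)\<^sup>*\<close> between \<open>x\<close> and \<open>y\<^sup>*\<close>.\<close>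

lemma norm_poly_act_mult_star_poly_act_le:
  assumes "\<And>z. cmod z = 1 \<Longrightarrow> cmod (poly p z) * cmod (poly q z) \<le> B"
  shows "norm (poly_act p x * star (poly_act q y)) \<le> norm x * norm y * B"
proof -
  have "poly_act p x * star (poly_act q y) = star (poly_act q y * star (poly_act p x))"
    by (simp add: star_mult star_star)
  also have "\<dots> = (R' ^^ degree q) (poly_act (conj_reflect q * p) x) * star y"
    by (simp add: poly_act_mult_star star_mult star_star poly_act_mult)
  finally have "norm (poly_act p x * star (poly_act q y)) \<le> norm (poly_act (conj_reflect q * p) x) * norm y"
    using norm_mult_ineq[of "(R' ^^ degree q) (poly_act (conj_reflect q * p) x)" "star y"] by simp
  also have "\<dots> \<le> (norm x * B) * norm y"
    using assms
    by (intro mult_right_mono norm_poly_act_le)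
       (auto simp: poly_conj_reflect norm_mult norm_power mult.commute)
  finally show ?thesis by (simp add: mult_ac)
qed

lemma poly_act_R_power: "poly_act p ((R ^^ n) x) = (R ^^ n) (poly_act p x)"
  by (induction n) (simp_all add: poly_act_R)

lemma norm_laurent_act_mult_star_laurent_act_le:
  assumes "\<And>z. cmod z = 1 \<Longrightarrow> cmod (poly p z / z ^ N) * cmod (poly q z / z ^ M) \<le> B"
  shows "norm (laurent_act N p x * star (laurent_act M q y)) \<le> norm x * norm y * B"
proof -
  have "laurent_act N p x * star (laurent_act M q y) = poly_act p ((R ^^ M) ((R' ^^ N) x)) * star (poly_act q y)"
    by (simp add: laurent_act_def poly_act_R'_power poly_act_R_power flip: R_power_mult_star)
  also have "norm \<dots> \<le> norm ((R ^^ M) ((R' ^^ N) x)) * norm y * B"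
    using assms by (intro norm_poly_act_mult_star_poly_act_le) (auto simp: norm_divide norm_power)
  finally show ?thesis by simp
qed

text \<open>Laurent approximations of \<open>f\<close> and \<open>g\<close> have a product that tends to 0 uniformly on the circle, because
  \<open>f * g = 0\<close>, so the products of their actions tend to 0 in norm. As \<open>g\<close> is real,
  \<open>star (cont_act g y)\<close> is the left action of \<open>g\<close> on \<open>star y\<close>.\<close>

lemma cont_act_disjoint:
  assumes "\<And>z. apply_bcontfun f z * apply_bcontfun g z = 0"
  shows "cont_act f x * star (cont_act g y) = 0"
proof -
  obtain r N p where r0: "r \<longlonglongrightarrow> 0" "\<And>n. r n \<ge> 0"
    and Np: "\<And>n. laurent_near f (N n) (p n) (r n)"
    "\<And>x. (\<lambda>n. laurent_act (N n) (p n) x) \<longlonglongrightarrow> cont_act f x" by (rule laurent_near_seq[of f]) (rule that)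
  obtain s M q where s0: "s \<longlonglongrightarrow> 0" "\<And>n. s n \<ge> 0"
    and Mq: "\<And>n. laurent_near g (M n) (q n) (s n)"
    "\<And>x. (\<lambda>n. laurent_act (M n) (q n) x) \<longlonglongrightarrow> cont_act g x" by (rule laurent_near_seq[of g]) (rule that)
  let ?s = "\<lambda>n. laurent_act (N n) (p n) x * star (laurent_act (M n) (q n) y)"
  have "?s \<longlonglongrightarrow> cont_act f x * star (cont_act g y)"
    by (intro tendsto_mult Np(2) bounded_linear.tendsto[OF bounded_linear_star] Mq(2))
  moreover have "?s \<longlonglongrightarrow> 0"
  proof (rule Lim_null_comparison)
    show "\<forall>\<^sub>F n in sequentially. norm (?s n) \<le> norm x * norm y * (r n * norm g + s n * norm f + r n * s n)"
    proof (intro always_eventually allI norm_laurent_act_mult_star_laurent_act_le)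
      fix n z assume z: "cmod z = 1"
      let ?f = "apply_bcontfun f z" and ?g = "apply_bcontfun g z"
      note rn = r0(2)[of n] s0(2)[of n]
      have 1: "cmod (poly (p n) z / z ^ N n) \<le> \<bar>?f\<bar> + r n"
        using Np(1)[of n] z norm_triangle_sub[of "poly (p n) z / z ^ N n" "of_real ?f"]
        by (auto simp: laurent_near_def norm_minus_commute intro: order_trans)
      have 2: "cmod (poly (q n) z / z ^ M n) \<le> \<bar>?g\<bar> + s n"
        using Mq(1)[of n] z norm_triangle_sub[of "poly (q n) z / z ^ M n" "of_real ?g"]
        by (auto simp: laurent_near_def norm_minus_commute intro: order_trans)
      have "cmod (poly (p n) z / z ^ N n) * cmod (poly (q n) z / z ^ M n) \<le> (\<bar>?f\<bar> + r n) * (\<bar>?g\<bar> + s n)"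
        using 1 2 rn by (intro mult_mono) auto
      also have "\<dots> = \<bar>?f * ?g\<bar> + (r n * \<bar>?g\<bar> + s n * \<bar>?f\<bar> + r n * s n)"
        by (simp add: abs_mult algebra_simps)
      also have "\<dots> = (r n * \<bar>?g\<bar> + s n * \<bar>?f\<bar> + r n * s n)"
        by (simp only: assms abs_zero add_0_left)
      also have "\<dots> \<le> r n * norm g + s n * norm f + r n * s n"
        using norm_bounded[of f z] norm_bounded[of g z] rn
        by (intro mult_left_mono add_mono) auto
      finally show "cmod (poly (p n) z / z ^ N n) * cmod (poly (q n) z / z ^ M n)
          \<le> r n * norm g + s n * norm f + r n * s n" .
    qed
    show "(\<lambda>n. norm x * norm y * (r n * norm g + s n * norm f + r n * s n)) \<longlonglongrightarrow> 0"
      using r0 s0 by (auto intro!: tendsto_eq_intros)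
  qed
  ultimately show ?thesis using LIMSEQ_unique by blast
qed

section \<open>Bilinear maps that vanish on zero products\<close>

text \<open>The element in the middle is twice the real part of \<open>\<zeta> u\<close>, up to a multiple of the unit, over which
  \<open>\<phi>\<close> is balanced anyway. So the lemma on disjoint functions is applied to the function
  \<open>(1 + Re (\<zeta> z)) / 2\<close>, which has values between 0 and 1 on the circle.\<close>

lemma balanced_real_part:
  fixes \<phi> :: "'a \<Rightarrow> 'a \<Rightarrow> 'w::real_normed_vector"
  assumes \<phi>: "bounded_bilinear \<phi>"
    and zp: "\<And>a b. a * b = 0 \<Longrightarrow> \<phi> a b = 0"
    and \<zeta>: "cmod \<zeta> = 1"
  shows "\<phi> (a * (\<zeta> *\<^sub>C v + cnj \<zeta> *\<^sub>C star v)) b = \<phi> a ((\<zeta> *\<^sub>C v + cnj \<zeta> *\<^sub>C star v) * b)"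
proof -
  interpret \<phi>: bounded_bilinear \<phi> by (fact \<phi>)
  let ?one = "const_bcontfun 1 :: complex \<Rightarrow>\<^sub>C real"
  let ?w = "\<zeta> *\<^sub>C v + cnj \<zeta> *\<^sub>C star v"
  define c where "c = star b"
  \<comment> \<open>The truncation is inactive on the circle; it makes the function bounded on the whole plane.\<close>
  define g :: "complex \<Rightarrow>\<^sub>C real" where
    "g = Bcontfun (\<lambda>z. max 0 (min 1 ((1 + Re (\<zeta> * z)) / 2)))"
  have g: "apply_bcontfun g z = max 0 (min 1 ((1 + Re (\<zeta> * z)) / 2))" for z
  proof -
    have "(\<lambda>z. max 0 (min 1 ((1 + Re (\<zeta> * z)) / 2))) \<in> bcontfun"
      unfolding bcontfun_def
      by (auto intro!: continuous_intros boundedI[where B=1])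
    then show ?thesis by (simp add: g_def Bcontfun_inverse)
  qed
  have one: "cont_act ?one x = x" for x
    using cont_act_laurent[of ?one 1 0 x] by (simp add: laurent_act_def const_bcontfun.rep_eq)
  have cg: "cont_act g x = ((1 / 2 + Re \<zeta> / 2) *\<^sub>R x) + (1 / 4) *\<^sub>R (x * ?w)" for x
  proof -
    have "cont_act g x = laurent_act 1 [:cnj \<zeta> / 4, 1 / 2, \<zeta> / 4:] x"
    proof (rule cont_act_laurent)
      fix z assume z: "cmod z = 1"
      then have "z \<noteq> 0" by auto
      have "cmod (\<zeta> * z) = 1" using z \<zeta> by (simp add: norm_mult)
      then have "\<bar>Re (\<zeta> * z)\<bar> \<le> 1" using abs_Re_le_cmod[of "\<zeta> * z"] by simp
      then have "apply_bcontfun g z = (1 + Re (\<zeta> * z)) / 2" unfolding g by auto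
      moreover have "complex_of_real (Re (\<zeta> * z)) = (\<zeta> * z + cnj \<zeta> * inverse z) / 2"
        using complex_add_cnj[of "\<zeta> * z"] cnj_unit_circle[OF z] by simp
      ultimately have "complex_of_real (apply_bcontfun g z) = (1 + (\<zeta> * z + cnj \<zeta> * inverse z) / 2) / 2"
        by (simp only: of_real_divide of_real_add of_real_1 of_real_numeral)
      also have "\<dots> = poly [:cnj \<zeta> / 4, 1 / 2, \<zeta> / 4:] z / z ^ 1"
        using \<open>z \<noteq> 0\<close> by (simp add: field_simps)
      finally show "complex_of_real (apply_bcontfun g z) = poly [:cnj \<zeta> / 4, 1 / 2, \<zeta> / 4:] z / z ^ 1" .
    qed
    also have "\<dots> = (cnj \<zeta> / 4) *\<^sub>C R' x + (1 / 2) *\<^sub>C x + (\<zeta> / 4) *\<^sub>C R x"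
      by (simp add: laurent_act_def poly_act_pCons R'_linear R_linear add.assoc)
    also have "\<dots> = (cnj \<zeta> / 4 + 1 / 2 + \<zeta> / 4) *\<^sub>C x + (x * ((\<zeta> / 4) *\<^sub>C v + (cnj \<zeta> / 4) *\<^sub>C star v))"
      by (simp add: R_def R'_def scaleC_add_right scaleC_add_left mult_scaleC_right ring_distribs add_ac)
    also have "cnj \<zeta> / 4 + 1 / 2 + \<zeta> / 4 = complex_of_real (1 / 2 + Re \<zeta> / 2)"
      by (simp add: complex_eq_iff)
    also have "(\<zeta> / 4) *\<^sub>C v + (cnj \<zeta> / 4) *\<^sub>C star v = (1 / 4) *\<^sub>R ?w"
      by (simp add: scaleR_scaleC scaleC_add_right scaleC_scaleC)
    finally show ?thesis by (simp add: scaleR_scaleC mult_scaleC_right)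
  qed
  have "bounded_bilinear (\<lambda>f g. \<phi> (cont_act f a) (star (cont_act g c)))"
    by (intro bounded_bilinear.comp[OF \<phi>] bounded_linear_cont_act
        bounded_linear_compose[OF bounded_linear_star])
  then have "\<phi> (cont_act g a) (star (cont_act ?one c)) = \<phi> (cont_act ?one a) (star (cont_act g c))"
    by (rule disjointness_bilinear_shift[where F = "\<lambda>f g. \<phi> (cont_act f a) (star (cont_act g c))"])
       (auto intro!: zp cont_act_disjoint simp: g)
  then have "\<phi> (a * ?w) (star c) = \<phi> a (star (c * ?w))"
    by (simp add: one cg \<phi>.add_left \<phi>.add_right \<phi>.scaleR_left \<phi>.scaleR_right star_add star_scaleR)
  then show ?thesis
    by (simp add: c_def star_mult star_add star_scaleC star_star add.commute)
qed

text \<open>Taking \<open>\<zeta> = 1\<close> and \<open>\<zeta> = - \<i>\<close> gives twice the real and imaginary parts of \<open>v\<close>.\<close>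

lemma balanced_quasi_unitary:
  fixes \<phi> :: "'a \<Rightarrow> 'a \<Rightarrow> 'w::real_normed_vector"
  assumes \<phi>: "bounded_bilinear \<phi>"
    and zp: "\<And>a b. a * b = 0 \<Longrightarrow> \<phi> a b = 0"
    and cx: "\<And>c a b. \<phi> (c *\<^sub>C a) b = \<phi> a (c *\<^sub>C b)"
  shows "\<phi> (a * v) b = \<phi> a (v * b)"
proof -
  interpret \<phi>: bounded_bilinear \<phi> by (fact \<phi>)
  let ?w1 = "1 *\<^sub>C v + cnj 1 *\<^sub>C star v"
  let ?w2 = "(-\<i>) *\<^sub>C v + cnj (-\<i>) *\<^sub>C star v"
  have v: "2 *\<^sub>R v = ?w1 + \<i> *\<^sub>C ?w2"
    by (simp add: scaleC_add_right scaleC_scaleC scaleC_minus_one scaleR_2)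
  have "2 *\<^sub>R \<phi> (a * v) b = \<phi> (a * ?w1) b + \<phi> (a * \<i> *\<^sub>C ?w2) b"
    unfolding \<phi>.scaleR_left[symmetric] mult_scaleR_right[symmetric] v
    by (simp only: ring_distribs \<phi>.add_left)
  also have "\<phi> (a * \<i> *\<^sub>C ?w2) b = \<phi> ((\<i> *\<^sub>C a) * ?w2) b"
    by (simp only: mult_scaleC_left mult_scaleC_right)
  also have "\<dots> = \<phi> a (\<i> *\<^sub>C (?w2 * b))"
    by (simp only: balanced_real_part[OF \<phi> zp] norm_minus_cancel norm_ii cx)
  also have "\<phi> (a * ?w1) b = \<phi> a (?w1 * b)"
    by (rule balanced_real_part[OF \<phi> zp]) simp_all
  also have "\<phi> a (?w1 * b) + \<phi> a (\<i> *\<^sub>C (?w2 * b)) = \<phi> a ((2 *\<^sub>R v) * b)"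
    unfolding v by (simp only: ring_distribs \<phi>.add_right mult_scaleC_left)
  finally show ?thesis by (simp add: \<phi>.scaleR_right)
qed

section \<open>Approximation by products\<close>

text \<open>Modulo the left ideal generated by \<open>v\<close>, the unitary \<open>u\<close> acts as 1, so \<open>p(u)\<close> acts as \<open>p(1)\<close>.\<close>

lemma poly_act_v_decomp: "\<exists>w. poly_act p v = poly p 1 *\<^sub>C v + w * v"
proof (induction p)
  case 0
  have "poly_act 0 v = poly 0 1 *\<^sub>C v + 0 * v" by simp
  then show ?case by blast
next
  case (pCons c p)
  then obtain w where w: "poly_act p v = poly p 1 *\<^sub>C v + w * v" by blast
  have "poly_act (pCons c p) v = poly (pCons c p) 1 *\<^sub>C v + (w + poly_act p v) * v"
    by (simp add: poly_act_pCons R_def w scaleC_add_left algebra_simps)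
  then show ?case by blast
qed

text \<open>As \<open>v = u - 1\<close>, the element \<open>v q(u)\<close> is the value of the function \<open>q(z) (z - 1)\<close> at \<open>u\<close>. There
  is no unit to act on, so the estimate is applied to the action on \<open>y\<^sup>*\<close> with \<open>y = v q(u)\<close>, which
  produces \<open>y\<^sup>* y\<close>.\<close>

lemma norm_poly_act_v_le:
  assumes "\<And>z. cmod z = 1 \<Longrightarrow> cmod (poly q z * (z - 1)) \<le> B"
  shows "norm (poly_act q v) \<le> B"
proof (cases "poly_act q v = 0")
  case True
  have "0 \<le> cmod (poly q 1 * (1 - 1))" by simp
  also have "\<dots> \<le> B" by (rule assms) simp
  finally show ?thesis using True by simp
next
  case False
  define y where "y = poly_act q v"
  have "star y * y = poly_act q (star y * v)"
    by (simp add: y_def poly_act_mult_left)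
  also have "star y * v = poly_act [:-1, 1:] (star y)"
    by (simp add: poly_act_pCons R_linear scaleC_minus_one R_def)
  finally have "star y * y = poly_act (q * [:-1, 1:]) (star y)"
    by (simp only: poly_act_mult)
  moreover have "norm (poly_act (q * [:-1, 1:]) (star y)) \<le> norm (star y) * B"
    using assms by (intro norm_poly_act_le) (auto simp: algebra_simps)
  ultimately have "(norm y)\<^sup>2 \<le> norm y * B"
    by (simp flip: norm_star_mult_self)
  then show ?thesis
    using False by (simp add: power2_eq_square y_def)
qed

text \<open>With \<open>q\<close> a power of \<open>(1 + z) / 2\<close>, the elements \<open>v q(u)\<close> differ from \<open>v\<close> by products, because
  \<open>q(1) = 1\<close>, and they tend to 0. So \<open>v\<close> is a limit of products.\<close>

lemma vanishes_if_vanishes_on_products: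
  fixes L :: "'a \<Rightarrow> 'w::real_normed_vector"
  assumes L: "bounded_linear L" and prod: "\<And>x y. L (x * y) = 0"
  shows "L v = 0"
proof -
  interpret L: bounded_linear L by (fact L)
  define q :: "nat \<Rightarrow> complex poly" where "q n = [:1/2, 1/2:] ^ n" for n
  have "L (poly_act (q n) v) = L v" for n
  proof -
    obtain w where "poly_act (q n) v = poly (q n) 1 *\<^sub>C v + w * v" using poly_act_v_decomp by blast
    then show ?thesis by (simp add: q_def L.add prod)
  qed
  moreover have "(\<lambda>n. poly_act (q n) v) \<longlonglongrightarrow> 0"
  proof (rule Lim_null_comparison)
    show "\<forall>\<^sub>F n in sequentially. norm (poly_act (q n) v) \<le> 2 / sqrt (real n + 1)"
      unfolding q_def by (intro always_eventually allI norm_poly_act_v_le half_plus_power_bound)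
    show "(\<lambda>n. 2 / sqrt (real n + 1)) \<longlonglongrightarrow> 0" by real_asymp
  qed
  then have "(\<lambda>n. L (poly_act (q n) v)) \<longlonglongrightarrow> L 0" by (rule L.tendsto)
  ultimately show ?thesis
    by (simp add: L.zero LIMSEQ_const_iff)
qed

end

section \<open>From unitaries to arbitrary elements\<close>

text \<open>The Cayley transform \<open>u = (1 + k) / (1 - k)\<close> is unitary for skew-adjoint \<open>k\<close>. The equation for
  \<open>v = u - 1\<close> is \<open>(1 - k) u = 1 + k\<close>; it has a unique solution by Banach's fixed point theorem.\<close>

lemma cayley_quasi_unitary:
  fixes k :: "'a::c_star_algebra"
  assumes skew: "star k = - k" and small: "norm k < 1"
  obtains v where "quasi_unitary v" "v = 2 *\<^sub>R k + k * v" "k * v = v * k"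
proof -
  have contr: "norm (k * x) \<le> norm k * norm x" for x by (rule norm_mult_ineq)
  have fp: "\<exists>!x. a + k * x = x" for a
  proof (rule banach_fix_type)
    show "\<forall>x y. dist (a + k * x) (a + k * y) \<le> norm k * dist x y"
      using contr by (simp add: dist_norm flip: right_diff_distrib)
  qed (use small in auto)
  from fp[of "2 *\<^sub>R k"] obtain v where v: "2 *\<^sub>R k + k * v = v" by blast
  have kv: "2 *\<^sub>R (k * k) + k * (k * v) = k * v"
    using arg_cong[OF v, of "\<lambda>x. k * x"] by (simp add: algebra_simps)
  have vk: "2 *\<^sub>R (k * k) + k * (v * k) = v * k"
    using arg_cong[OF v, of "\<lambda>x. x * k"] by (simp add: algebra_simps)
  \<comment> \<open>Both products solve the same fixed point equation.\<close>
  have comm: "k * v = v * k"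
    using fp[of "2 *\<^sub>R (k * k)"] kv vk by blast
  have sv: "star v = - (2 *\<^sub>R k) - star v * k"
    using arg_cong[OF v, of star] by (simp add: star_add star_mult star_scaleR skew)
  \<comment> \<open>If \<open>s\<close> is the defect of one of the unitarity equations, then \<open>s (1 + k) = 0\<close> or
    \<open>s (1 - k) = 0\<close>, and the norm of \<open>k\<close> is less than 1.\<close>
  have zero: "x = 0" if "norm x \<le> norm x * norm k" for x :: 'a
  proof (rule ccontr)
    assume "x \<noteq> 0"
    then have "norm x * norm k < norm x * 1" using small by (intro mult_strict_left_mono) auto
    with that show False by simp
  qed
  have "v + star v + v * star v = 0"
  proof (rule zero)
    let ?s = "v + star v + v * star v"
    have svk: "star v * k = - (2 *\<^sub>R k) - star v" using sv by (simp add: algebra_simps)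
    have vk': "v * k = v - 2 *\<^sub>R k" using v comm by (simp add: algebra_simps)
    have "?s * k = v * k + star v * k + v * (star v * k)" by (simp add: algebra_simps)
    also have "\<dots> = - ?s" unfolding svk by (simp add: algebra_simps vk' scaleR_2)
    finally show "norm ?s \<le> norm ?s * norm k" using norm_mult_ineq[of ?s k] by (simp del: add_uminus_conv_diff minus_add_distrib)
  qed
  moreover have "v + star v + star v * v = 0"
  proof (rule zero)
    let ?s = "v + star v + star v * v"
    have svk: "star v * k = - (2 *\<^sub>R k) - star v" using sv by (simp add: algebra_simps)
    have vk': "v * k = v - 2 *\<^sub>R k" using v comm by (simp add: algebra_simps)
    have "?s * k = v * k + star v * k + star v * (v * k)" by (simp add: algebra_simps)
    also have "\<dots> = ?s" unfolding vk' by (simp add: algebra_simps svk scaleR_2)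
    finally show "norm ?s \<le> norm ?s * norm k" using norm_mult_ineq[of ?s k] by simp
  qed
  ultimately have "quasi_unitary v" by unfold_locales
  then show thesis by (rule that[OF _ v[symmetric] comm])
qed

text \<open>Every element is a complex combination of two skew-adjoint ones, \<open>x - x\<^sup>*\<close> and \<open>\<i> (x + x\<^sup>*)\<close>,
  which can be scaled to be small.\<close>

lemma skew_adjoint_contraction_induct:
  fixes P :: "'a::c_star_algebra \<Rightarrow> bool"
  assumes skew: "\<And>k. star k = - k \<Longrightarrow> norm k < 1 \<Longrightarrow> P k"
    and add: "\<And>x y. P x \<Longrightarrow> P y \<Longrightarrow> P (x + y)"
    and scale: "\<And>c x. P x \<Longrightarrow> P (c *\<^sub>C x)"
  shows "P x"
proof -
  have skew': "P k" if k: "star k = - k" for k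
  proof -
    define r where "r = inverse (norm k + 1)"
    have r: "r > 0" "r * norm k < 1"
    proof -
      have "norm k + 1 > 0" by (simp add: add_nonneg_pos)
      then show "r > 0" "r * norm k < 1" by (simp_all add: r_def inverse_eq_divide pos_divide_less_eq)
    qed
    have "P (r *\<^sub>R k)"
      using r by (intro skew) (auto simp: star_scaleR k)
    then have "P (complex_of_real (inverse r) *\<^sub>C (r *\<^sub>R k))" by (rule scale)
    also have "complex_of_real (inverse r) *\<^sub>C (r *\<^sub>R k) = k"
      unfolding scaleR_scaleC[symmetric] using r by simp
    finally show "P k" .
  qed
  have "P (x - star x)" by (rule skew') (simp add: star_diff star_star)
  moreover have "P (\<i> *\<^sub>C (x + star x))"
    by (rule skew') (simp add: star_scaleC star_add star_star scaleC_minus_left add.commute)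
  ultimately have "P ((1/2) *\<^sub>C (x - star x) + (- \<i> / 2) *\<^sub>C (\<i> *\<^sub>C (x + star x)))"
    by (rule add[OF scale scale])
  also have "(1/2) *\<^sub>C (x - star x) + (- \<i> / 2) *\<^sub>C (\<i> *\<^sub>C (x + star x)) = x"
  proof -
    have "(1/2) *\<^sub>C (x - star x) + (- \<i> / 2) *\<^sub>C (\<i> *\<^sub>C (x + star x)) = (1/2) *\<^sub>C x + (1/2) *\<^sub>C x"
      by (simp add: scaleC_scaleC scaleC_add_right scaleC_diff_right)
    also have "\<dots> = x" by (simp flip: scaleC_add_left)
    finally show ?thesis .
  qed
  finally show ?thesis .
qed

text \<open>The Cayley transform gives a balanced \<open>v\<close> with \<open>v = 2 k + k v = 2 k + v k\<close>. The failure \<open>\<delta>\<close> of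
  balancedness of \<open>k\<close> then satisfies \<open>\<delta> a (2 c + v c) = 0\<close> for all \<open>c\<close>, and \<open>c = b - k b\<close> turns the
  second argument into \<open>2 b\<close>.\<close>

theorem zero_product_balanced:
  fixes \<phi> :: "'a::c_star_algebra \<Rightarrow> 'a \<Rightarrow> 'w::real_normed_vector"
  assumes \<phi>: "bounded_bilinear \<phi>"
    and zp: "\<And>a b. a * b = 0 \<Longrightarrow> \<phi> a b = 0"
    and cx: "\<And>c a b. \<phi> (c *\<^sub>C a) b = \<phi> a (c *\<^sub>C b)"
  shows "\<phi> (a * x) b = \<phi> a (x * b)"
proof -
  interpret \<phi>: bounded_bilinear \<phi> by (fact \<phi>)
  have "\<forall>a b. \<phi> (a * x) b = \<phi> a (x * b)"
  proof (rule skew_adjoint_contraction_induct[where x = x])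
    fix k :: 'a assume k: "star k = - k" "norm k < 1"
    obtain v where "quasi_unitary v" and v: "v = 2 *\<^sub>R k + k * v" and comm: "k * v = v * k"
      using cayley_quasi_unitary[OF k] .
    then have bal: "\<phi> (a * v) b = \<phi> a (v * b)" for a b
      by (intro quasi_unitary.balanced_quasi_unitary \<phi> zp cx)
    have vb: "v * b = 2 *\<^sub>R (k * b) + k * (v * b)" for b
      using arg_cong[OF v, of "\<lambda>x. x * b"] by (simp add: algebra_simps)
    have av: "a * v = 2 *\<^sub>R (a * k) + (a * k) * v" for a
      using arg_cong[OF v, of "\<lambda>x. a * x"] by (simp add: algebra_simps)
    define \<delta> where "\<delta> a b = \<phi> (a * k) b - \<phi> a (k * b)" for a b
    show "\<forall>a b. \<phi> (a * k) b = \<phi> a (k * b)"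
    proof (intro allI)
      fix a b
      have \<delta>: "2 *\<^sub>R \<delta> a c + \<delta> a (v * c) = 0" for c
      proof -
        have "2 *\<^sub>R \<phi> (a * k) c + \<phi> (a * k) (v * c) = \<phi> (a * v) c"
          using arg_cong[OF av[of a], of "\<lambda>x. \<phi> x c"] by (simp add: \<phi>.add_left \<phi>.scaleR_left bal)
        moreover have "2 *\<^sub>R \<phi> a (k * c) + \<phi> a (k * (v * c)) = \<phi> a (v * c)"
          using arg_cong[OF vb[of c], of "\<phi> a"] by (simp add: \<phi>.add_right \<phi>.scaleR_right)
        ultimately show ?thesis
          using bal[of a c] by (simp add: \<delta>_def algebra_simps)
      qed
      have vc: "v * (b - k * b) = 2 *\<^sub>R (k * b)"
        using vb[of b] comm by (simp add: algebra_simps flip: mult.assoc)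
      have "2 *\<^sub>R \<delta> a b = 2 *\<^sub>R \<delta> a (b - k * b) + \<delta> a (v * (b - k * b))"
        unfolding vc by (simp add: \<delta>_def \<phi>.diff_right \<phi>.scaleR_right algebra_simps)
      then have "\<delta> a b = 0" by (simp add: \<delta>)
      then show "\<phi> (a * k) b = \<phi> a (k * b)" by (simp add: \<delta>_def)
    qed
  next
    fix x y :: 'a
    assume "\<forall>a b. \<phi> (a * x) b = \<phi> a (x * b)" "\<forall>a b. \<phi> (a * y) b = \<phi> a (y * b)"
    then show "\<forall>a b. \<phi> (a * (x + y)) b = \<phi> a ((x + y) * b)"
      by (simp add: ring_distribs \<phi>.add_left \<phi>.add_right)
  next
    fix c and x :: 'a
    assume "\<forall>a b. \<phi> (a * x) b = \<phi> a (x * b)"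
    then show "\<forall>a b. \<phi> (a * (c *\<^sub>C x)) b = \<phi> a ((c *\<^sub>C x) * b)"
      by (metis cx mult_scaleC_left mult_scaleC_right)
  qed
  then show ?thesis by blast
qed

text \<open>The Cayley transform \<open>v\<close> of \<open>k\<close> differs from \<open>2 k\<close> by the product \<open>k v\<close>. The claim is proved for all
  complex multiples at once, since \<open>L\<close> is only real-linear.\<close>

lemma zero_if_zero_on_products:
  fixes L :: "'a::c_star_algebra \<Rightarrow> 'w::real_normed_vector"
  assumes L: "bounded_linear L" and prod: "\<And>x y. L (x * y) = 0"
  shows "L x = 0"
proof -
  interpret L: bounded_linear L by (fact L)
  have "\<forall>c. L (c *\<^sub>C x) = 0"
  proof (rule skew_adjoint_contraction_induct[where x = x])
    fix k :: 'a assume k: "star k = - k" "norm k < 1"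
    obtain v where qv: "quasi_unitary v" and v: "v = 2 *\<^sub>R k + k * v" and "k * v = v * k"
      using cayley_quasi_unitary[OF k] .
    show "\<forall>c. L (c *\<^sub>C k) = 0"
    proof
      fix c
      have Lc: "bounded_linear (\<lambda>x. L (c *\<^sub>C x))"
        by (rule bounded_linear_compose[OF L bounded_linear_scaleC])
      interpret Lc: bounded_linear "\<lambda>x. L (c *\<^sub>C x)" by (fact Lc)
      have prod': "L (c *\<^sub>C (x * y)) = 0" for x y
        using prod[of "c *\<^sub>C x" y] by (simp add: mult_scaleC_left)
      have "L (c *\<^sub>C v) = 0"
        by (rule quasi_unitary.vanishes_if_vanishes_on_products[OF qv Lc prod'])
      also have "L (c *\<^sub>C v) = 2 *\<^sub>R L (c *\<^sub>C k)"
        by (subst v) (simp only: Lc.add Lc.scaleR prod' add_0_right)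
      finally show "L (c *\<^sub>C k) = 0" by simp
    qed
  qed (simp_all add: scaleC_add_right L.add scaleC_scaleC)
  then have "L (1 *\<^sub>C x) = 0" by blast
  then show ?thesis by simp
qed

section \<open>Multiplicativity of 2-local representations\<close>

theorem zero_product_alternating_eq_0:
  fixes D :: "'a::c_star_algebra \<Rightarrow> 'a \<Rightarrow> 'w::real_normed_vector"
  assumes D: "bounded_bilinear D"
    and zp: "\<And>a b. a * b = 0 \<Longrightarrow> D a b = 0"
    and cx: "\<And>c a b. D (c *\<^sub>C a) b = D a (c *\<^sub>C b)"
    and alt: "\<And>a. D a a = 0"
  shows "D a b = 0"
proof -
  interpret D: bounded_bilinear D by (fact D)
  have anti: "D x y = - D y x" for x y
  proof -
    have "0 = D (x + y) (x + y)" by (simp only: alt)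
    also have "\<dots> = D x y + D y x" unfolding D.add_left D.add_right by (simp add: alt)
    finally show ?thesis by (simp add: eq_neg_iff_add_eq_0)
  qed
  have bal: "D (x * y) z = D x (y * z)" for x y z
    by (rule zero_product_balanced[OF D zp cx])
  \<comment> \<open>Balancedness and antisymmetry together move the factors cyclically, with a sign; after three
    steps the product is back and the sign is negative.\<close>
  have "D (x * y) z = 0" for x y z
  proof -
    have "D (x * y) z = - D (y * z) x" by (simp add: bal anti[of x])
    also have "\<dots> = D (z * x) y" by (simp add: bal anti[of y])
    also have "\<dots> = - D (x * y) z" by (simp add: bal anti[of z])
    finally show ?thesis by (simp add: eq_neg_iff_add_eq_0 flip: scaleR_2)
  qed
  then show ?thesis
    by (rule zero_if_zero_on_products[OF D.bounded_linear_left])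
qed

theorem jordan_zero_product_multiplicative:
  fixes T :: "'a::c_star_algebra \<Rightarrow> 'b::complex_normed_algebra"
  assumes T: "bounded_clinear T"
    and square: "\<And>a. T (a * a) = T a * T a"
    and zp: "\<And>a b. a * b = 0 \<Longrightarrow> T a * T b = 0"
  shows "T (a * b) = T a * T b"
proof -
  have bl: "bounded_linear T" and Tc: "\<And>c x. T (c *\<^sub>C x) = c *\<^sub>C T x"
    using T by (auto simp: bounded_clinear_def)
  interpret T: bounded_linear T by (fact bl)
  define D where "D a b = T (a * b) - T a * T b" for a b
  obtain K where K: "K \<ge> 0" "\<And>x. norm (T x) \<le> norm x * K"
    using T.nonneg_bounded by blast
  have "norm (D a b) \<le> norm a * norm b * (K + K * K)" for a b
  proof -
    have "norm (T (a * b)) \<le> (norm a * norm b) * K"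
      using K(2)[of "a * b"] norm_mult_ineq[of a b] K(1) by (meson mult_right_mono order_trans)
    moreover have "norm (T a * T b) \<le> (norm a * K) * (norm b * K)"
      using K by (intro order_trans[OF norm_mult_ineq] mult_mono) auto
    ultimately show ?thesis
      using norm_triangle_ineq4[of "T (a * b)" "T a * T b"] by (simp add: D_def algebra_simps)
  qed
  then have bound: "\<exists>K. \<forall>a b. norm (D a b) \<le> norm a * norm b * K"
    by (intro exI allI)
  have "bounded_bilinear D"
    by (rule bounded_bilinear.intro[OF _ _ _ _ bound])
       (simp_all add: D_def T.add T.scaleR ring_distribs scaleR_diff_right)
  then have "D a b = 0"
    by (rule zero_product_alternating_eq_0)
       (simp_all add: D_def zp square T.zero Tc mult_scaleC_left mult_scaleC_right)
  then show ?thesis by (simp add: D_def)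
qed

theorem corollary3p10:
  fixes T :: "'a::c_star_algebra \<Rightarrow> 'h::complex_hilbert_space bounded_op"
  assumes "two_local_representation T"
  shows "cstar_representation T"
proof -
  have T: "bounded_clinear T"
    and local: "\<And>a b. \<exists>\<Phi>. bounded_homomorphism \<Phi> \<and> \<Phi> a = T a \<and> \<Phi> b = T b"
    using assms by (auto simp: two_local_representation_def)
  have square: "T (a * a) = T a * T a" for a
  proof -
    obtain \<Phi> where "bounded_homomorphism \<Phi>" "\<Phi> a = T a" "\<Phi> (a * a) = T (a * a)"
      using local by blast
    then show ?thesis by (metis bounded_homomorphism_def)
  qed
  have zp: "T a * T b = 0" if "a * b = 0" for a b
  proof -
    obtain \<Phi> where \<Phi>: "bounded_homomorphism \<Phi>" "\<Phi> a = T a" "\<Phi> b = T b"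
      using local by blast
    then have "T a * T b = \<Phi> (a * b)" by (metis bounded_homomorphism_def)
    also have "\<dots> = 0"
      using \<Phi>(1) that bounded_linear.axioms(1)[THEN linear_0]
      by (auto simp: bounded_homomorphism_def bounded_clinear_def)
    finally show ?thesis .
  qed
  have "T (a * b) = T a * T b" for a b
    using T square zp by (rule jordan_zero_product_multiplicative)
  with T show ?thesis
    by (simp add: cstar_representation_def bounded_homomorphism_def)
qed

end
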